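(* Fix a correlation graph $\Gamma$ whose cycle space is generated by triangles, and let $\eta>0$. On the class of labelled configurations $n_1,\ldots,n_m\in S^2$ with correlation graph $\Gamma$ satisfying $$|\rho_{ij}|\ge\eta\qquad(ij\in E(\Gamma)),$$ pair reconstruction obeys $$|a-\tilde a|\le\frac{3\pi}{2\arcsin\eta}\left|I_2(a)-I_2(\tilde a)\right|$$ for $a,\tilde a\in[\eta,1]$, while every feasible pair of triple switching classes (that is, for the absolute correlations $a,b,c\in[\eta,1)$ of a triangle of $\Gamma$ such that both $G_+(a,b,c)$ and $G_-(a,b,c)$ are positive semidefinite) satisfies $$J_+(a,b,c)-J_-(a,b,c)\ge\frac{\eta^3}{2\pi}.$$
   Context: For $n_1,\ldots,n_m\in S^2$ put $\rho_{ij}=n_i\cdot n_j$; the correlation graph has vertex set $\{1,\ldots,m\}$ and an edge $ij$ ($i\neq j$) exactly when $\rho_{ij}\ne0$; its cycle space is taken over $\mathbb{F}_2$. With $U$ uniformly distributed on $S^2$, $I_2(\rho)=\mathbb{E}(|U\cdot n||U\cdot n'|)$ for any $n,n'\in S^2$ with $|n\cdot n'|=\rho\in[0,1]$ (it depends only on $\rho$), and $I_3(n_1,n_2,n_3)=\mathbb{E}(|U\cdot n_1||U\cdot n_2||U\cdot n_3|)$, which depends only on the Gram matrix. For $a,b,c\in(0,1)$ let $G_\pm(a,b,c)=\begin{pmatrix} 1 & a & b \\ a & 1 & \pm c \\ b & \pm c & 1 \end{pmatrix}$; whenever $G_\pm(a,b,c)$ is positive semidefinite, $J_\pm(a,b,c)$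 is the value of $I_3$ for three unit vectors in $\mathbb{R}^3$ with Gram matrix $G_\pm(a,b,c)$. *)

theory Defs
  imports "HOL-Probability.Probability" "HOL-Library.Z2" "HOL-Library.Function_Algebras"
begin

section \<open>The uniform distribution on the sphere\<close>

text \<open>
  The library has no surface measure, so the uniform law is defined as the cone measure: the law of
  \<open>X / |X|\<close> for \<open>X\<close> uniform in the unit ball (\<open>sgn x = x / |x|\<close>).  It is a probability measure on the
  Borel sets of the ambient space, carried by the sphere and invariant under every orthogonal
  transformation (proved below); these properties characterise the normalised surface measure.
\<close>

definition uniform_S2 :: "(real^3) measure" where
  "uniform_S2 = distr (uniform_measure lborel (ball 0 1)) borel sgn"

lemma sgn_borel_measurable: "(sgn :: real^3 \<Rightarrow> real^3) \<in> borel_measurable borel"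
  unfolding sgn_div_norm[abs_def] by measurable

lemma emeasure_unit_ball3:
  "emeasure lborel (ball (0::real^3) 1) \<noteq> 0" "emeasure lborel (ball (0::real^3) 1) \<noteq> \<infinity>"
proof -
  have "measure lborel (ball (0::real^3) 1) > 0"
    using content_ball_pos[of 1 "0::real^3"] by simp
  then show "emeasure lborel (ball (0::real^3) 1) \<noteq> 0"
    by (auto simp: measure_def)
  show "emeasure lborel (ball (0::real^3) 1) \<noteq> \<infinity>"
    using emeasure_lborel_ball_finite[of "0::real^3" 1] by auto
qed

lemma prob_space_uniform_S2: "prob_space uniform_S2"
  unfolding uniform_S2_def
  by (intro prob_space.prob_space_distr prob_space_uniform_measure emeasure_unit_ball3)
     (use sgn_borel_measurable in simp)

lemma AE_uniform_S2_sphere: "AE U in uniform_S2. U \<in> sphere 0 1"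
proof -
  have "AE x in lborel. x \<noteq> (0::real^3)"
    by (rule AE_lborel_singleton)
  then have "AE x in uniform_measure lborel (ball 0 1). sgn (x::real^3) \<in> sphere 0 1"
    by (intro AE_uniform_measureI) (auto simp: norm_sgn)
  then show ?thesis
    unfolding uniform_S2_def
    by (subst AE_distr_iff) (use sgn_borel_measurable in auto)
qed

lemma distr_lborel_orthogonal:
  fixes T :: "real^3 \<Rightarrow> real^3"
  assumes T: "orthogonal_transformation T"
  shows "distr lborel borel T = lborel"
proof (rule lborel_eqI[symmetric])
  have lin: "linear T" using T by (simp add: orthogonal_transformation_linear)
  have Tm: "T \<in> borel_measurable borel"
    using lin by (intro borel_measurable_continuous_onI linear_continuous_on linear_conv_bounded_linear[THEN iffD1])
  have invT: "orthogonal_transformation (inv T)" "bij T"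
    using T orthogonal_transformation_inv orthogonal_transformation_bij by auto
  show "sets (distr lborel borel T) = sets borel" by simp
  fix l u :: "real^3" assume "\<And>b. b \<in> Basis \<Longrightarrow> l \<bullet> b \<le> u \<bullet> b"
  have vim: "T -` box l u = inv T ` box l u"
    using invT(2) by (simp add: bij_vimage_eq_inv_image)
  have mb: "inv T ` box l u \<in> sets borel"
    unfolding vim[symmetric] using measurable_sets[OF Tm, of "box l u"] by simp
  have lm: "inv T ` box l u \<in> lmeasurable"
    using measurable_orthogonal_image[OF invT(1)] by simp
  have "emeasure (distr lborel borel T) (box l u) = emeasure lborel (inv T ` box l u)"
    using Tm by (subst emeasure_distr) (auto simp: vim)
  also have "\<dots> = emeasure lebesgue (inv T ` box l u)"
    using mb by simp
  also have "\<dots> = ennreal (measure lebesgue (inv T ` box l u))"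
    using lm by (simp add: emeasure_eq_measure2)
  also have "\<dots> = ennreal (measure lebesgue (box l u))"
    using measure_orthogonal_image[OF invT(1), of "box l u"] by simp
  also have "\<dots> = emeasure lborel (box l u)"
    using emeasure_lborel_box_finite[of l u]
    by (subst emeasure_eq_ennreal_measure) (auto simp: less_top)
  finally show "emeasure (distr lborel borel T) (box l u) = ennreal (\<Prod>b\<in>Basis. (u - l) \<bullet> b)"
    using \<open>\<And>b. b \<in> Basis \<Longrightarrow> l \<bullet> b \<le> u \<bullet> b\<close> by (simp add: emeasure_lborel_box)
qed

lemma uniform_S2_orthogonal_invariant:
  assumes T: "orthogonal_transformation T"
  shows "distr uniform_S2 borel T = uniform_S2"
proof (rule measure_eqI)
  have lin: "linear T" using T by (simp add: orthogonal_transformation_linear)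
  have Tm: "T \<in> borel_measurable borel"
    using lin by (intro borel_measurable_continuous_onI linear_continuous_on linear_conv_bounded_linear[THEN iffD1])
  have normT: "norm (T x) = norm x" for x using T by (simp add: orthogonal_transformation_norm)
  have sgnT: "T (sgn x) = sgn (T x)" for x
    using lin by (simp add: sgn_div_norm normT linear_scale)
  show "sets (distr uniform_S2 borel T) = sets uniform_S2" by (simp add: uniform_S2_def)
  fix A assume "A \<in> sets (distr uniform_S2 borel T)"
  then have A[measurable]: "A \<in> sets borel" by simp
  note [measurable] = Tm sgn_borel_measurable
  have sA: "sgn -` A \<in> sets borel"
    using measurable_sets[OF sgn_borel_measurable A] by simp
  have e: "emeasure uniform_S2 B =
      emeasure lborel (ball 0 1 \<inter> sgn -` B) / emeasure lborel (ball (0::real^3) 1)"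
    if B: "B \<in> sets borel" for B
    unfolding uniform_S2_def using B measurable_sets[OF sgn_borel_measurable B]
    by (subst emeasure_distr) auto
  have TA: "T -` A \<in> sets borel" using measurable_sets[OF Tm A] by simp
  have "emeasure (distr uniform_S2 borel T) A = emeasure uniform_S2 (T -` A)"
    by (subst emeasure_distr) (auto simp: uniform_S2_def)
  also have "ball 0 1 \<inter> sgn -` (T -` A) = T -` (ball 0 1 \<inter> sgn -` A)"
    by (auto simp: sgnT normT)
  then have "emeasure uniform_S2 (T -` A) =
      emeasure lborel (T -` (ball 0 1 \<inter> sgn -` A)) / emeasure lborel (ball (0::real^3) 1)"
    using e[OF TA] by simp
  also have "emeasure lborel (T -` (ball 0 1 \<inter> sgn -` A))
      = emeasure (distr lborel borel T) (ball 0 1 \<inter> sgn -` A)"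
    using sA by (subst emeasure_distr) auto
  also have "\<dots> = emeasure lborel (ball 0 1 \<inter> sgn -` A)"
    by (simp add: distr_lborel_orthogonal[OF T])
  also have "\<dots> / emeasure lborel (ball (0::real^3) 1) = emeasure uniform_S2 A"
    using e[OF A] by simp
  finally show "emeasure (distr uniform_S2 borel T) A = emeasure uniform_S2 A" .
qed


section \<open>Absolute moments\<close>

text \<open>
  \<open>I2 \<rho>\<close> is the common value of the pair moment over all unit vectors with
  \<open>|n \<bullet> n'| = \<rho>\<close>.  It is meaningful only for \<open>\<rho> \<in> [0, 1]\<close>; elsewhere no such vectors exist and
  the definite description is unspecified.
\<close>

definition I2 :: "real \<Rightarrow> real" where
  "I2 \<rho> = (THE v. \<forall>n\<in>sphere 0 1. \<forall>n'\<in>sphere 0 1. \<bar>n \<bullet> n'\<bar> = \<rho> \<longrightarrow>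
              (\<integral>U. \<bar>U \<bullet> n\<bar> * \<bar>U \<bullet> n'\<bar> \<partial>uniform_S2) = v)"

definition I3 :: "real^3 \<Rightarrow> real^3 \<Rightarrow> real^3 \<Rightarrow> real" where
  "I3 n1 n2 n3 = (\<integral>U. \<bar>U \<bullet> n1\<bar> * \<bar>U \<bullet> n2\<bar> * \<bar>U \<bullet> n3\<bar> \<partial>uniform_S2)"

definition gram3 :: "real^3 \<Rightarrow> real^3 \<Rightarrow> real^3 \<Rightarrow> real^3^3" where
  "gram3 n1 n2 n3 = vector [vector [n1 \<bullet> n1, n1 \<bullet> n2, n1 \<bullet> n3],
                            vector [n2 \<bullet> n1, n2 \<bullet> n2, n2 \<bullet> n3],
                            vector [n3 \<bullet> n1, n3 \<bullet> n2, n3 \<bullet> n3]]"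

definition pos_semidef :: "real^'n^'n \<Rightarrow> bool" where
  "pos_semidef A \<longleftrightarrow> transpose A = A \<and> (\<forall>x. x \<bullet> (A *v x) \<ge> 0)"

definition G_plus :: "real \<Rightarrow> real \<Rightarrow> real \<Rightarrow> real^3^3" where
  "G_plus a b c = vector [vector [1, a, b], vector [a, 1, c], vector [b, c, 1]]"

definition G_minus :: "real \<Rightarrow> real \<Rightarrow> real \<Rightarrow> real^3^3" where
  "G_minus a b c = vector [vector [1, a, b], vector [a, 1, - c], vector [b, - c, 1]]"

text \<open>
  The value of \<open>I3\<close> at any unit vectors with Gram matrix \<open>G\<close>; meaningful only when \<open>G\<close> is positive
  semidefinite with unit diagonal, since otherwise there are no such vectors.
\<close>

definition I3_of_gram :: "real^3^3 \<Rightarrow> real" where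
  "I3_of_gram G = (THE v. \<forall>n1\<in>sphere 0 1. \<forall>n2\<in>sphere 0 1. \<forall>n3\<in>sphere 0 1.
                     gram3 n1 n2 n3 = G \<longrightarrow> I3 n1 n2 n3 = v)"

definition J_plus :: "real \<Rightarrow> real \<Rightarrow> real \<Rightarrow> real" where
  "J_plus a b c = I3_of_gram (G_plus a b c)"

definition J_minus :: "real \<Rightarrow> real \<Rightarrow> real \<Rightarrow> real" where
  "J_minus a b c = I3_of_gram (G_minus a b c)"


section \<open>Correlation graphs\<close>

text \<open>
  A labelled configuration is a map \<open>n :: nat \<Rightarrow> real^3\<close> of which only the values on the vertex set
  \<open>{1..m}\<close> matter.  A graph on that vertex set is given by its set of edges, each a two-element set.
\<close>

definition configuration :: "nat \<Rightarrow> (nat \<Rightarrow> real^3) \<Rightarrow> bool" where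
  "configuration m n \<longleftrightarrow> (\<forall>i\<in>{1..m}. n i \<in> sphere 0 1)"

definition correlation_edges :: "nat \<Rightarrow> (nat \<Rightarrow> real^3) \<Rightarrow> nat set set" where
  "correlation_edges m n = {{i, j} |i j. i \<in> {1..m} \<and> j \<in> {1..m} \<and> i \<noteq> j \<and> n i \<bullet> n j \<noteq> 0}"

definition correlation_graph :: "nat \<Rightarrow> nat set set \<Rightarrow> bool" where
  "correlation_graph m E \<longleftrightarrow> (\<exists>n. configuration m n \<and> correlation_edges m n = E)"

definition bounded_class :: "nat \<Rightarrow> nat set set \<Rightarrow> real \<Rightarrow> (nat \<Rightarrow> real^3) set" where
  "bounded_class m E \<eta> = {n. configuration m n \<and> correlation_edges m n = E \<and>
       (\<forall>i j. {i, j} \<in> E \<longrightarrow> \<bar>n i \<bullet> n j\<bar> \<ge> \<eta>)}"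

text \<open>\<open>bit\<close> is the field with two elements; edge chains form a vector space over it.\<close>

abbreviation chain_scale :: "bit \<Rightarrow> ('e \<Rightarrow> bit) \<Rightarrow> 'e \<Rightarrow> bit" where
  "chain_scale c z \<equiv> (\<lambda>e. c * z e)"

global_interpretation chain: vector_space "chain_scale :: bit \<Rightarrow> ('e \<Rightarrow> bit) \<Rightarrow> 'e \<Rightarrow> bit"
  defines chain_span = chain.span
  by unfold_locales (auto simp: fun_eq_iff algebra_simps)

text \<open>The kernel of the boundary map from edge chains to vertex chains.\<close>

definition cycle_space :: "nat set set \<Rightarrow> (nat set \<Rightarrow> bit) set" where
  "cycle_space E = {z. (\<forall>e. e \<notin> E \<longrightarrow> z e = 0) \<and> (\<forall>v. (\<Sum>e\<in>{e\<in>E. v \<in> e}. z e) = 0)}"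

definition is_triangle :: "nat set set \<Rightarrow> nat \<Rightarrow> nat \<Rightarrow> nat \<Rightarrow> bool" where
  "is_triangle E i j k \<longleftrightarrow> distinct [i, j, k] \<and> {i, j} \<in> E \<and> {i, k} \<in> E \<and> {j, k} \<in> E"

definition triangle_cycle :: "nat \<Rightarrow> nat \<Rightarrow> nat \<Rightarrow> nat set \<Rightarrow> bit" where
  "triangle_cycle i j k = (\<lambda>e. of_bool (e \<in> {{i, j}, {i, k}, {j, k}}))"

definition generated_by_triangles :: "nat set set \<Rightarrow> bool" where
  "generated_by_triangles E \<longleftrightarrow>
     chain_span {triangle_cycle i j k |i j k. is_triangle E i j k} = cycle_space E"

end

theory Submission
  imports Defs
begin

text \<open>
  The moments are homogeneous, so up to explicit constants they may be computed against the
  Gaussian weight \<open>exp (- |x|\<^sup>2 / 2)\<close> on \<open>\<real>\<^sup>3\<close> instead of the uniform law of the sphere.  Writing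
  \<open>\<pi> |x|\<close> as the integral of \<open>(1 - cos (s x)) / s\<^sup>2\<close> over the real line and applying Tonelli's theorem
  turns a moment into an integral of an explicit combination of Gaussian characteristic functions
  divided by \<open>r\<^sup>2 s\<^sup>2 t\<^sup>2\<close>.  Changing the sign of the correlation \<open>c\<close> alters that combination by
  \<open>2 exp (- (r\<^sup>2 + s\<^sup>2 + t\<^sup>2) / 2) sinh (a r s) sinh (b r t) sinh (c s t)\<close>, which is at least
  \<open>2 a b c r\<^sup>2 s\<^sup>2 t\<^sup>2 exp (- (r\<^sup>2 + s\<^sup>2 + t\<^sup>2) / 2)\<close>; integrating gives the gap \<open>a b c / (2 \<pi>)\<close>.
  For pairs the same representation contains \<open>cosh (a r s)\<close>, and the convexity of \<open>cosh\<close> bounds its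
  increments below by \<open>sinh (\<eta> r s)\<close>, half the integral of \<open>r s exp (u r s)\<close> over \<open>|u| \<le> \<eta>\<close>; the Gaussian
  integral over \<open>r\<close> and \<open>s\<close> leaves \<open>1 / sqrt (1 - u\<^sup>2)\<close>, hence \<open>arcsin \<eta>\<close>.
\<close>

section \<open>Gaussian integrals and the cosine representation of the absolute value\<close>

text \<open>Completing the square exhibits the integrand as a multiple of the normal density with
  mean \<open>p / q\<close> and variance \<open>1 / q\<close>, whose total mass is 1.\<close>

lemma nn_integral_exp_quadratic:
  fixes p q :: real
  assumes q: "q > 0"
  shows "(\<integral>\<^sup>+s. ennreal (exp (p * s - q * s\<^sup>2 / 2)) \<partial>lborel) = ennreal (sqrt (2 * pi / q) * exp (p\<^sup>2 / (2 * q)))"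
proof -
  define \<sigma> where "\<sigma> = 1 / sqrt q"
  have s: "\<sigma> > 0" using q by (simp add: \<sigma>_def)
  have s2: "\<sigma>\<^sup>2 = 1 / q" using q by (simp add: \<sigma>_def power_divide)
  let ?K = "sqrt (2 * pi / q) * exp (p\<^sup>2 / (2 * q))"
  have eq: "exp (p * x - q * x\<^sup>2 / 2) = ?K * normal_density (p / q) \<sigma> x" for x
  proof -
    have "- ((x - p / q)\<^sup>2 / (2 * (1 / q))) + p\<^sup>2 / (2 * q) = p * x - q * x\<^sup>2 / 2"
      using q by (simp add: power2_eq_square field_simps)
    then show ?thesis
      using q unfolding normal_density_def s2
      by (simp add: real_sqrt_divide real_sqrt_mult exp_add[symmetric] add.commute)
  qed
  have "(\<integral>\<^sup>+x. ennreal (normal_density (p / q) \<sigma> x) \<partial>lborel) = 1"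
    using s by (subst nn_integral_eq_integral) (auto intro: integrable_normal_density)
  then show ?thesis
    using q unfolding eq
    by (simp add: ennreal_mult nn_integral_cmult)
qed

text \<open>Passing to \<open>iexp\<close> turns the phase into a product over coordinates, so the
  integral reduces to one-dimensional characteristic functions of the standard normal law; the
  cosine is recovered as the real part.\<close>

lemma has_bochner_integral_cos_gaussian:
  fixes v :: "'a::euclidean_space"
  shows "has_bochner_integral lborel (\<lambda>x. cos (v \<bullet> x) * exp (- (norm x)\<^sup>2 / 2))
           (sqrt (2 * pi) ^ DIM('a) * exp (- (norm v)\<^sup>2 / 2))"
proof -
  let ?g = "\<lambda>b x. iexp ((v \<bullet> b) * x) * complex_of_real (exp (- x\<^sup>2 / 2))"
  have den: "exp (- x\<^sup>2 / 2) = sqrt (2 * pi) * std_normal_density x" for x :: real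
    by (simp add: normal_density_def)
  have g_int: "integrable lborel (?g b)" for b
  proof (rule Bochner_Integration.integrable_bound)
    show "integrable lborel (\<lambda>x. sqrt (2 * pi) * std_normal_density x)"
      by simp
  qed (auto simp: normal_density_def norm_mult)
  have g_val: "integral\<^sup>L lborel (?g b) = complex_of_real (sqrt (2 * pi) * exp (- (v \<bullet> b)\<^sup>2 / 2))" for b
  proof -
    have "integral\<^sup>L lborel (?g b)
        = (\<integral>x. sqrt (2 * pi) *\<^sub>R (std_normal_density x *\<^sub>R iexp ((v \<bullet> b) * x)) \<partial>lborel)"
      by (intro Bochner_Integration.integral_cong) (simp_all add: normal_density_def scaleR_conv_of_real)
    also have "\<dots> = sqrt (2 * pi) *\<^sub>R (\<integral>x. std_normal_density x *\<^sub>R iexp ((v \<bullet> b) * x) \<partial>lborel)"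
      by (rule integral_scaleR_right)
    also have "\<dots> = sqrt (2 * pi) *\<^sub>R char std_normal_distribution (v \<bullet> b)"
      by (simp add: char_def integral_density)
    finally show ?thesis
      by (simp add: char_std_normal_distribution scaleR_conv_of_real)
  qed
  interpret product_sigma_finite "\<lambda>_::'a. lborel :: real measure" ..
  \<comment> \<open>Lebesgue measure on the space is the image under \<open>?T\<close> of the
    product of one-dimensional Lebesgue measures over \<open>Basis\<close>.\<close>
  let ?T = "\<lambda>f. \<Sum>b\<in>(Basis::'a set). f b *\<^sub>R b"
  let ?G = "\<lambda>x::'a. \<Prod>b\<in>Basis. ?g b (x \<bullet> b)"
  have GT: "?G (?T f) = (\<Prod>b\<in>Basis. ?g b (f b))" for f
    by (intro prod.cong) auto
  have T: "?T \<in> measurable (Pi\<^sub>M Basis (\<lambda>_. lborel)) borel" by measurable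
  have Gm: "?G \<in> borel_measurable borel" by measurable
  have G_int: "integrable lborel ?G"
    unfolding lborel_eq[where 'a='a]
    by (subst integrable_distr_eq[OF T Gm], unfold GT)
       (intro product_integrable_prod g_int finite_Basis)
  have G_val: "integral\<^sup>L lborel ?G = (\<Prod>b\<in>Basis. complex_of_real (sqrt (2 * pi) * exp (- (v \<bullet> b)\<^sup>2 / 2)))"
    unfolding lborel_eq[where 'a='a]
    by (subst integral_distr[OF T Gm], unfold GT, subst product_integral_prod)
       (simp_all only: g_int g_val finite_Basis)
  have nsq: "(norm x)\<^sup>2 = (\<Sum>b\<in>Basis. (x \<bullet> b)\<^sup>2)" for x :: 'a
    unfolding power2_norm_eq_inner by (subst euclidean_inner) (simp add: power2_eq_square)
  have ex: "(\<Prod>b\<in>Basis. exp (- (x \<bullet> b)\<^sup>2 / 2)) = exp (- (norm x)\<^sup>2 / 2)" for x :: 'a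
    by (simp add: nsq exp_sum[symmetric] sum_negf sum_divide_distrib)
  have cis: "(\<Prod>b\<in>Basis. iexp ((v \<bullet> b) * (x \<bullet> b))) = iexp (v \<bullet> x)" for x :: 'a
    by (subst euclidean_inner) (simp add: exp_sum[symmetric] sum_distrib_left)
  have G_eq: "?G x = iexp (v \<bullet> x) * complex_of_real (exp (- (norm x)\<^sup>2 / 2))" for x
    by (simp only: prod.distrib cis of_real_prod[symmetric] ex)
  have Re_G: "Re (?G x) = cos (v \<bullet> x) * exp (- (norm x)\<^sup>2 / 2)" for x
    unfolding G_eq by (simp add: cis_conv_exp[symmetric])
  have "integral\<^sup>L lborel ?G = complex_of_real (sqrt (2 * pi) ^ DIM('a) * exp (- (norm v)\<^sup>2 / 2))"
    unfolding G_val by (simp only: of_real_prod[symmetric] prod.distrib ex prod_constant)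
  then have "has_bochner_integral lborel ?G (complex_of_real (sqrt (2 * pi) ^ DIM('a) * exp (- (norm v)\<^sup>2 / 2)))"
    using G_int by (simp add: has_bochner_integral_iff)
  from has_bochner_integral_bounded_linear[OF bounded_linear_Re this] show ?thesis
    unfolding Re_G by simp
qed

lemma nn_integral_std_gaussian:
  "(\<integral>\<^sup>+s. ennreal (exp (- (s::real)\<^sup>2 / 2)) \<partial>lborel) = ennreal (sqrt (2 * pi))"
  using nn_integral_exp_quadratic[of 1 0] by simp

text \<open>The integrand is the integral of \<open>u * exp (- (u * s)\<^sup>2 / 2)\<close> over u
  in [0, 1]; after exchanging the order, the Gaussian integral in s supplies \<open>1 / u\<close>
  and cancels the factor \<open>u\<close>.\<close>

lemma nn_integral_one_minus_gaussian:
  "(\<integral>\<^sup>+s. ennreal ((1 - exp (- (s::real)\<^sup>2 / 2)) / s\<^sup>2) \<partial>lborel) = ennreal (sqrt (2 * pi))"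
proof -
  have "(\<integral>\<^sup>+s. ennreal ((1 - exp (- (s::real)\<^sup>2 / 2)) / s\<^sup>2) \<partial>lborel)
      = (\<integral>\<^sup>+s. \<integral>\<^sup>+u. ennreal (u * exp (- (u * s)\<^sup>2 / 2)) * indicator {0..1} u \<partial>lborel \<partial>lborel)"
  proof (rule nn_integral_cong_AE)
    show "AE s in lborel. ennreal ((1 - exp (- (s::real)\<^sup>2 / 2)) / s\<^sup>2) =
       (\<integral>\<^sup>+u. ennreal (u * exp (- (u * s)\<^sup>2 / 2)) * indicator {0..1} u \<partial>lborel)"
      using AE_lborel_singleton[of "0::real"]
    proof eventually_elim
      fix s :: real assume s: "s \<noteq> 0"
      have "(\<integral>\<^sup>+u. ennreal (u * exp (- (u * s)\<^sup>2 / 2)) * indicator {0..1} u \<partial>lborel)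
        = ennreal (- exp (- (1 * s)\<^sup>2 / 2) / s\<^sup>2 - - exp (- (0 * s)\<^sup>2 / 2) / s\<^sup>2)"
      proof (rule nn_integral_FTC_Icc[where F = "\<lambda>u. - exp (- (u * s)\<^sup>2 / 2) / s\<^sup>2"])
        fix x :: real
        show "((\<lambda>u. - exp (- (u * s)\<^sup>2 / 2) / s\<^sup>2) has_real_derivative x * exp (- (x * s)\<^sup>2 / 2)) (at x)"
          using s by (auto intro!: derivative_eq_intros simp: power2_eq_square field_simps)
      qed auto
      then show "ennreal ((1 - exp (- s\<^sup>2 / 2)) / s\<^sup>2) =
       (\<integral>\<^sup>+u. ennreal (u * exp (- (u * s)\<^sup>2 / 2)) * indicator {0..1} u \<partial>lborel)"
        by (simp add: diff_divide_distrib)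
    qed
  qed
  also have "\<dots> = (\<integral>\<^sup>+u. \<integral>\<^sup>+s. ennreal (u * exp (- (u * s)\<^sup>2 / 2)) * indicator {0..1} u \<partial>lborel \<partial>lborel)"
    by (rule lborel_pair.Fubini') measurable
  \<comment> \<open>The point \<open>u = 0\<close> is left out because the inner integral vanishes
    there.\<close>
  also have "\<dots> = (\<integral>\<^sup>+u. ennreal (sqrt (2 * pi)) * indicator {0<..1} (u::real) \<partial>lborel)"
  proof (rule nn_integral_cong)
    fix u :: real
    show "(\<integral>\<^sup>+s. ennreal (u * exp (- (u * s)\<^sup>2 / 2)) * indicator {0..1} u \<partial>lborel)
      = ennreal (sqrt (2 * pi)) * indicator {0<..1} u"
    proof (cases "0 < u \<and> u \<le> 1")
      case True
      then have "(\<integral>\<^sup>+s. ennreal (u * exp (- (u * s)\<^sup>2 / 2)) * indicator {0..1} u \<partial>lborel)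
         = ennreal u * (\<integral>\<^sup>+s. ennreal (exp (0 * s - u\<^sup>2 * s\<^sup>2 / 2)) \<partial>lborel)"
        by (subst nn_integral_cmult[symmetric])
           (auto intro!: nn_integral_cong simp: ennreal_mult power_mult_distrib)
      also have "\<dots> = ennreal u * ennreal (sqrt (2 * pi / u\<^sup>2))"
        using True by (subst nn_integral_exp_quadratic) auto
      also have "\<dots> = ennreal (sqrt (2 * pi))"
        using True by (simp add: ennreal_mult[symmetric] real_sqrt_divide)
      finally show ?thesis using True by simp
    next
      case False
      then show ?thesis
        by (cases "u = 0") (auto simp: indicator_def)
    qed
  qed
  also have "\<dots> = ennreal (sqrt (2 * pi))"
    by (simp add: nn_integral_cmult)
  finally show ?thesis .
qed

lemma nn_integral_abs_gaussian:
  "(\<integral>\<^sup>+x. ennreal (\<bar>x\<bar> * exp (- (x::real)\<^sup>2 / 2)) \<partial>lborel) = 2"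
proof -
  have "(\<integral>\<^sup>+x. ennreal (\<bar>x\<bar> * exp (- (x::real)\<^sup>2 / 2)) \<partial>lborel)
     = (\<integral>\<^sup>+x. ennreal (sqrt (2 * pi)) * ennreal (std_normal_density x * \<bar>x\<bar> ^ (2 * 0 + 1)) \<partial>lborel)"
    by (auto intro!: nn_integral_cong simp: normal_density_def ennreal_mult[symmetric])
  also have "\<dots> = ennreal (sqrt (2 * pi)) * ennreal (sqrt (2 / pi) * 2^0 * fact 0)"
    by (subst nn_integral_cmult, simp, subst nn_integral_eq_integral)
       (use has_bochner_integral_integrable std_normal_moment_abs_odd[of 0] integral_std_normal_moment_abs_odd[of 0] in \<open>auto simp: has_bochner_integral_iff\<close>)
  also have "\<dots> = ennreal (sqrt (2 * pi) * sqrt (2 / pi))"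
    by (simp add: ennreal_mult)
  also have "sqrt (2 * pi) * sqrt (2 / pi) = 2"
    by (simp add: real_sqrt_mult[symmetric])
  finally show ?thesis by simp
qed

text \<open>
  The integral is \<open>|x|\<close> times a constant by scaling; averaging over a standard Gaussian \<open>x\<close>
  identifies the constant.
\<close>

lemma nn_integral_one_minus_cos:
  fixes x :: real
  shows "(\<integral>\<^sup>+s. ennreal ((1 - cos (s * x)) / s\<^sup>2) \<partial>lborel) = ennreal (pi * \<bar>x\<bar>)"
proof -
  define C where "C = (\<integral>\<^sup>+s. ennreal ((1 - cos s) / s\<^sup>2) \<partial>(lborel :: real measure))"
  have scale: "(\<integral>\<^sup>+s. ennreal ((1 - cos (s * x)) / s\<^sup>2) \<partial>lborel) = ennreal \<bar>x\<bar> * C" for x :: real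
  proof (cases "x = 0")
    case False
    have "C = ennreal \<bar>x\<bar> * (\<integral>\<^sup>+s. ennreal ((1 - cos (0 + x * s)) / (0 + x * s)\<^sup>2) \<partial>lborel)"
      unfolding C_def by (rule nn_integral_real_affine) (use False in auto)
    then have "ennreal \<bar>x\<bar> * C = ennreal (x\<^sup>2) * (\<integral>\<^sup>+s. ennreal ((1 - cos (x * s)) / (x * s)\<^sup>2) \<partial>lborel)"
      by (simp add: mult.assoc[symmetric] ennreal_mult[symmetric] power2_eq_square)
    also have "\<dots> = (\<integral>\<^sup>+s. ennreal ((1 - cos (s * x)) / s\<^sup>2) \<partial>lborel)"
      using False by (subst nn_integral_cmult[symmetric])
        (auto intro!: nn_integral_cong simp: ennreal_mult[symmetric] power_mult_distrib mult.commute[of x])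
    finally show ?thesis by simp
  qed auto
  let ?f = "\<lambda>x s. ennreal ((1 - cos (s * x)) / s\<^sup>2) * ennreal (exp (- (x::real)\<^sup>2 / 2))"
  \<comment> \<open>The double integral of \<open>?f\<close> is evaluated in both orders:
    integrating in s first gives \<open>C * 2\<close>, integrating in x first gives
    \<open>2 * pi\<close>.\<close>
  have "C * 2 = (\<integral>\<^sup>+x. C * ennreal (\<bar>x\<bar> * exp (- (x::real)\<^sup>2 / 2)) \<partial>lborel)"
    by (subst nn_integral_cmult) (simp_all only: nn_integral_abs_gaussian, measurable)
  also have "\<dots> = (\<integral>\<^sup>+x. \<integral>\<^sup>+s. ?f x s \<partial>lborel \<partial>lborel)"
  proof (rule nn_integral_cong)
    fix x :: real
    have "(\<integral>\<^sup>+s. ?f x s \<partial>lborel) = ennreal \<bar>x\<bar> * C * ennreal (exp (- x\<^sup>2 / 2))"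
      by (subst nn_integral_multc) (simp_all only: scale, measurable)
    then show "C * ennreal (\<bar>x\<bar> * exp (- x\<^sup>2 / 2)) = (\<integral>\<^sup>+s. ?f x s \<partial>lborel)"
      by (simp only: ennreal_mult'' exp_ge_zero mult_ac)
  qed
  also have "\<dots> = (\<integral>\<^sup>+s. \<integral>\<^sup>+x. ?f x s \<partial>lborel \<partial>lborel)"
    by (rule lborel_pair.Fubini') measurable
  also have "\<dots> = (\<integral>\<^sup>+s. ennreal (sqrt (2 * pi)) * ennreal ((1 - exp (- s\<^sup>2 / 2)) / s\<^sup>2) \<partial>lborel)"
  proof (rule nn_integral_cong)
    fix s :: real
    let ?e = "\<lambda>x::real. exp (- x\<^sup>2 / 2)"
    have "has_bochner_integral lborel (\<lambda>x. (cos (0 * x) * ?e x - cos (s * x) * ?e x) / s\<^sup>2)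
       ((sqrt (2 * pi) - sqrt (2 * pi) * exp (- s\<^sup>2 / 2)) / s\<^sup>2)"
      using has_bochner_integral_cos_gaussian[of s] has_bochner_integral_cos_gaussian[of "0::real"]
      by (intro has_bochner_integral_divide has_bochner_integral_diff) auto
    then have h: "has_bochner_integral lborel (\<lambda>x. (1 - cos (s * x)) / s\<^sup>2 * ?e x)
       (sqrt (2 * pi) * ((1 - exp (- s\<^sup>2 / 2)) / s\<^sup>2))"
      by (simp add: algebra_simps diff_divide_distrib)
    have "(\<integral>\<^sup>+x. ?f x s \<partial>lborel) = (\<integral>\<^sup>+x. ennreal ((1 - cos (s * x)) / s\<^sup>2 * ?e x) \<partial>lborel)"
      by (intro nn_integral_cong) (simp only: ennreal_mult'' exp_ge_zero)
    also have "\<dots> = ennreal (sqrt (2 * pi) * ((1 - exp (- s\<^sup>2 / 2)) / s\<^sup>2))"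
      using h by (subst nn_integral_eq_integral) (auto simp: has_bochner_integral_iff)
    finally show "(\<integral>\<^sup>+x. ?f x s \<partial>lborel) = ennreal (sqrt (2 * pi)) * ennreal ((1 - exp (- s\<^sup>2 / 2)) / s\<^sup>2)"
      by (subst ennreal_mult'[symmetric]) simp_all
  qed
  also have "\<dots> = ennreal (2 * pi)"
    by (subst nn_integral_cmult, measurable, subst nn_integral_one_minus_gaussian)
       (simp add: ennreal_mult[symmetric])
  finally have "C * 2 = ennreal pi * 2" by (simp add: ennreal_mult mult.commute)
  \<comment> \<open>\<open>C\<close> is not yet known to be finite, so the factor 2 is removed by
    division in \<open>ennreal\<close>.\<close>
  then have "C * 2 / 2 = ennreal pi * 2 / 2" by simp
  then have "C = ennreal pi"
    by (subst (asm) (1 2) ennreal_mult_divide_eq) simp_all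
  then show ?thesis by (simp add: scale ennreal_mult mult.commute)
qed


section \<open>From the Gaussian weight to the sphere\<close>

text \<open>The dilation by \<open>r\<close> contributes \<open>r ^ d\<close> from homogeneity and
  \<open>r ^ DIM('a)\<close> from the Jacobian.\<close>

lemma nn_integral_ball_homogeneous:
  fixes F :: "'a::euclidean_space \<Rightarrow> ennreal"
  assumes [measurable]: "F \<in> borel_measurable borel"
    and hom: "\<And>t x. t > 0 \<Longrightarrow> F (t *\<^sub>R x) = ennreal (t ^ d) * F x"
    and r: "r > 0"
  shows "(\<integral>\<^sup>+x. F x * indicator (ball 0 r) x \<partial>lborel)
       = ennreal (r ^ (d + DIM('a))) * (\<integral>\<^sup>+x. F x * indicator (ball 0 1) x \<partial>lborel)"
proof -
  have [measurable]: "ball (0::'a) 1 \<in> sets borel" "ball (0::'a) r \<in> sets borel" by simp_all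
  have ind: "indicator (ball 0 r) (0 + r *\<^sub>R x) = (indicator (ball 0 1) x :: ennreal)" for x :: 'a
    using r by (auto simp: indicator_def)
  have "(\<integral>\<^sup>+x. F x * indicator (ball 0 r) x \<partial>lborel)
      = (\<integral>\<^sup>+x. F x * indicator (ball 0 r) x
          \<partial>density (distr lborel borel (\<lambda>x::'a. 0 + r *\<^sub>R x)) (\<lambda>_. ennreal (\<bar>r\<bar> ^ DIM('a))))"
    using lborel_affine[of r "0::'a"] r by simp
  also have "\<dots> = (\<integral>\<^sup>+x. ennreal (r ^ DIM('a)) * (F (0 + r *\<^sub>R x) * indicator (ball 0 r) (0 + r *\<^sub>R x)) \<partial>lborel)"
    using r by (subst nn_integral_density) (simp_all add: nn_integral_distr nn_integral_cmult abs_of_pos)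
  also have "\<dots> = (\<integral>\<^sup>+x. ennreal (r ^ (d + DIM('a))) * (F x * indicator (ball 0 1) x) \<partial>lborel)"
    unfolding ind using r by (auto intro!: nn_integral_cong simp: hom power_add ennreal_mult mult_ac)
  also have "\<dots> = ennreal (r ^ (d + DIM('a))) * (\<integral>\<^sup>+x. F x * indicator (ball 0 1) x \<partial>lborel)"
    by (rule nn_integral_cmult) measurable
  finally show ?thesis .
qed

text \<open>A radial weight that is a tail integral of \<open>k\<close> is a superposition of
  indicators of centred balls. Tonelli's theorem puts the radius outside, and the scaling law for
  balls separates it from \<open>F\<close>.\<close>

lemma nn_integral_layer_cake_homogeneous:
  fixes F :: "'a::euclidean_space \<Rightarrow> ennreal"
  assumes [measurable]: "F \<in> borel_measurable borel" "k \<in> borel_measurable borel"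
    and hom: "\<And>t x. t > 0 \<Longrightarrow> F (t *\<^sub>R x) = ennreal (t ^ d) * F x"
  shows "(\<integral>\<^sup>+x. F x * (\<integral>\<^sup>+s. k s * indicator {norm x..} s \<partial>lborel) \<partial>lborel)
       = (\<integral>\<^sup>+s. k s * ennreal (s ^ (d + DIM('a))) * indicator {0..} s \<partial>lborel)
         * (\<integral>\<^sup>+x. F x * indicator (ball 0 1) x \<partial>lborel)"
proof -
  have [measurable]: "ball (0::'a) s \<in> sets borel" for s by simp
  let ?B = "\<integral>\<^sup>+x. F x * indicator (ball 0 1) x \<partial>lborel"
  have "(\<integral>\<^sup>+x. F x * (\<integral>\<^sup>+s. k s * indicator {norm x..} s \<partial>lborel) \<partial>lborel)
      = (\<integral>\<^sup>+x. \<integral>\<^sup>+s. F x * (k s * indicator {y. norm x < y} s) \<partial>lborel \<partial>lborel)"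
  proof (rule nn_integral_cong)
    fix x :: 'a
    \<comment> \<open>The closed ray is replaced by an open one, at the cost of a null set, so that
      the condition on x describes an open ball.\<close>
    have "(\<integral>\<^sup>+s. k s * indicator {norm x..} s \<partial>lborel)
        = (\<integral>\<^sup>+s. k s * indicator {y. norm x < y} s \<partial>lborel)"
      by (rule nn_integral_cong_AE)
         (use AE_lborel_singleton[of "norm x"] in eventually_elim, auto simp: indicator_def)
    then show "F x * (\<integral>\<^sup>+s. k s * indicator {norm x..} s \<partial>lborel)
        = (\<integral>\<^sup>+s. F x * (k s * indicator {y. norm x < y} s) \<partial>lborel)"
      by (simp add: nn_integral_cmult)
  qed
  also have "\<dots> = (\<integral>\<^sup>+s. \<integral>\<^sup>+x. F x * (k s * indicator {y. norm x < y} s) \<partial>lborel \<partial>lborel)"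
    unfolding indicator_def mem_Collect_eq by (rule lborel_pair.Fubini') measurable
  also have "\<dots> = (\<integral>\<^sup>+s. k s * ennreal (s ^ (d + DIM('a))) * indicator {0..} s * ?B \<partial>lborel)"
  proof (rule nn_integral_cong_AE)
    \<comment> \<open>The scaling law needs a positive radius; negative s contribute nothing and
      \<open>s = 0\<close> is a null set.\<close>
    show "AE s in lborel. (\<integral>\<^sup>+x. F x * (k s * indicator {y. norm x < y} s) \<partial>lborel)
       = k s * ennreal (s ^ (d + DIM('a))) * indicator {0..} s * ?B"
      using AE_lborel_singleton[of "0::real"]
    proof eventually_elim
      fix s :: real assume "s \<noteq> 0"
      then consider "s > 0" | "s < 0" by linarith
      then show "(\<integral>\<^sup>+x. F x * (k s * indicator {y. norm x < y} s) \<partial>lborel)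
         = k s * ennreal (s ^ (d + DIM('a))) * indicator {0..} s * ?B"
      proof cases
        case 1
        have "(\<integral>\<^sup>+x. F x * (k s * indicator {y. norm x < y} s) \<partial>lborel)
            = (\<integral>\<^sup>+x. k s * (F x * indicator (ball 0 s) x) \<partial>lborel)"
          by (auto intro!: nn_integral_cong simp: indicator_def mult.commute)
        also have "\<dots> = k s * (ennreal (s ^ (d + DIM('a))) * ?B)"
          by (subst nn_integral_cmult) (measurable, simp only: nn_integral_ball_homogeneous[OF assms(1) hom 1])
        finally show ?thesis using 1 by (simp add: mult_ac)
      next
        case 2
        then have "indicator {y. norm x < y} s = (0::ennreal)" for x :: 'a
          by (auto simp: indicator_def not_less intro: order_trans[of s 0])
        with 2 show ?thesis by simp
      qed
    qed
  qed
  also have "\<dots> = (\<integral>\<^sup>+s. k s * ennreal (s ^ (d + DIM('a))) * indicator {0..} s \<partial>lborel) * ?B"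
    by (rule nn_integral_multc) measurable
  finally show ?thesis .
qed

text \<open>The Gaussian weight is the tail integral of \<open>s * exp (- s\<^sup>2 / 2)\<close>, so
  the layer-cake identity applies and leaves a half-line moment.\<close>

lemma nn_integral_gaussian_homogeneous:
  fixes F :: "'a::euclidean_space \<Rightarrow> ennreal"
  assumes [measurable]: "F \<in> borel_measurable borel"
    and hom: "\<And>t x. t > 0 \<Longrightarrow> F (t *\<^sub>R x) = ennreal (t ^ d) * F x"
  shows "(\<integral>\<^sup>+x. F x * ennreal (exp (- (norm x)\<^sup>2 / 2)) \<partial>lborel)
       = (\<integral>\<^sup>+s. ennreal (s ^ (d + DIM('a) + 1) * exp (- s\<^sup>2 / 2)) * indicator {0..} s \<partial>lborel)
         * (\<integral>\<^sup>+x. F x * indicator (ball 0 1) x \<partial>lborel)"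
proof -
  let ?k = "\<lambda>s::real. ennreal (s * exp (- s\<^sup>2 / 2))"
  have w: "(\<integral>\<^sup>+s. ?k s * indicator {r..} s \<partial>lborel) = ennreal (exp (- r\<^sup>2 / 2))" if "r \<ge> 0" for r
  proof -
    have "(\<integral>\<^sup>+s. ?k s * indicator {r..} s \<partial>lborel) = ennreal (0 - (- exp (- r\<^sup>2 / 2)))"
    proof (rule nn_integral_FTC_atLeast)
      show "((\<lambda>s. - exp (- s\<^sup>2 / 2)) has_real_derivative x * exp (- x\<^sup>2 / 2)) (at x)" for x :: real
        by (auto intro!: derivative_eq_intros)
      show "((\<lambda>s::real. - exp (- s\<^sup>2 / 2)) \<longlongrightarrow> 0) at_top"
        by real_asymp
    qed (use that in auto)
    then show ?thesis by simp
  qed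
  have "(\<integral>\<^sup>+x. F x * ennreal (exp (- (norm x)\<^sup>2 / 2)) \<partial>lborel)
      = (\<integral>\<^sup>+x. F x * (\<integral>\<^sup>+s. ?k s * indicator {norm x..} s \<partial>lborel) \<partial>lborel)"
    by (simp only: w norm_ge_zero)
  also have "\<dots> = (\<integral>\<^sup>+s. ?k s * ennreal (s ^ (d + DIM('a))) * indicator {0..} s \<partial>lborel)
         * (\<integral>\<^sup>+x. F x * indicator (ball 0 1) x \<partial>lborel)"
    by (rule nn_integral_layer_cake_homogeneous) (use hom in auto)
  also have "(\<integral>\<^sup>+s. ?k s * ennreal (s ^ (d + DIM('a))) * indicator {0..} s \<partial>lborel)
     = (\<integral>\<^sup>+s. ennreal (s ^ (d + DIM('a) + 1) * exp (- s\<^sup>2 / 2)) * indicator {0..} s \<partial>lborel)"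
    by (auto intro!: nn_integral_cong simp: indicator_def ennreal_mult[symmetric] mult_ac)
  finally show ?thesis .
qed

text \<open>
  On the ball, \<open>F (sgn x) = F x / |x| ^ d\<close>, and \<open>|x| ^ (-d)\<close> is again a superposition of indicators of
  balls (plus the constant 1).
\<close>

lemma nn_integral_uniform_S2_homogeneous:
  fixes F :: "real^3 \<Rightarrow> ennreal"
  assumes [measurable]: "F \<in> borel_measurable borel"
    and hom: "\<And>t x. t > 0 \<Longrightarrow> F (t *\<^sub>R x) = ennreal (t ^ d) * F x"
  shows "ennreal (4 * pi / 3) * (\<integral>\<^sup>+U. F U \<partial>uniform_S2)
       = ennreal (1 + d / 3) * (\<integral>\<^sup>+x. F x * indicator (ball 0 1) x \<partial>lborel)"
proof -
  note [measurable] = sgn_borel_measurable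
  have [measurable]: "ball (0::real^3) 1 \<in> sets borel" by simp
  let ?B = "\<integral>\<^sup>+x. F x * indicator (ball 0 1) x \<partial>lborel"
  \<comment> \<open>This is the derivative of \<open>- 1 / s ^ d\<close> cut off at 1, so that
    \<open>1 / r ^ d\<close> is 1 plus its integral from \<open>r\<close>.\<close>
  let ?k = "\<lambda>s::real. ennreal (d / s ^ (d + 1) * indicator {0<..1} s)"
  have w: "ennreal (1 / r ^ d) = 1 + (\<integral>\<^sup>+s. ?k s * indicator {r..} s \<partial>lborel)"
    if r: "0 < r" "r < 1" for r :: real
  proof -
    have "(\<integral>\<^sup>+s. ?k s * indicator {r..} s \<partial>lborel)
        = (\<integral>\<^sup>+s. ennreal (d / s ^ (d + 1)) * indicator {r..1} s \<partial>lborel)"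
      using r by (auto intro!: nn_integral_cong simp: indicator_def)
    also have "\<dots> = ennreal (- 1 / 1 ^ d - (- 1 / r ^ d))"
    proof (rule nn_integral_FTC_Icc)
      fix x assume "x \<in> {r..1}"
      then have "x > 0" using r by simp
      then show "((\<lambda>s. - 1 / s ^ d) has_real_derivative d / x ^ (d + 1)) (at x)"
        by (cases d) (auto intro!: derivative_eq_intros simp: divide_simps simp del: power_Suc, simp add: power2_eq_square power_add)
    qed (use r in auto)
    finally show ?thesis
      using r by (simp add: ennreal_plus[symmetric] power_le_one divide_simps del: ennreal_plus flip: ennreal_1)
  qed
  have V: "emeasure lborel (ball (0::real^3) 1) = ennreal (4 * pi / 3)"
    using emeasure_ball[of 1 "0::real^3"] by (simp add: unit_ball_vol_3)
  have "(\<integral>\<^sup>+U. F U \<partial>uniform_S2) = (\<integral>\<^sup>+x. F (sgn x) * indicator (ball 0 1) x \<partial>lborel) / ennreal (4 * pi / 3)"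
    unfolding uniform_S2_def
    by (subst nn_integral_distr, simp, simp, subst nn_integral_uniform_measure) (auto simp: V)
  then have "ennreal (4 * pi / 3) * (\<integral>\<^sup>+U. F U \<partial>uniform_S2) = (\<integral>\<^sup>+x. F (sgn x) * indicator (ball 0 1) x \<partial>lborel)"
    by (simp only: ennreal_times_divide) (subst mult.commute, rule ennreal_mult_divide_eq, auto)
  also have "\<dots> = (\<integral>\<^sup>+x. F x * indicator (ball 0 1) x + F x * (\<integral>\<^sup>+s. ?k s * indicator {norm x..} s \<partial>lborel) \<partial>lborel)"
  proof (rule nn_integral_cong_AE)
    show "AE x in lborel. F (sgn x) * indicator (ball 0 1) x
       = F x * indicator (ball 0 1) x + F x * (\<integral>\<^sup>+s. ?k s * indicator {norm x..} s \<partial>lborel)"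
      using AE_lborel_singleton[of "0::real^3"]
    proof eventually_elim
      fix x :: "real^3" assume x: "x \<noteq> 0"
      show "F (sgn x) * indicator (ball 0 1) x
       = F x * indicator (ball 0 1) x + F x * (\<integral>\<^sup>+s. ?k s * indicator {norm x..} s \<partial>lborel)"
      proof (cases "norm x < 1")
        case True
        have "F (sgn x) = F ((1 / norm x) *\<^sub>R x)"
          by (simp add: sgn_div_norm divide_inverse)
        also have "\<dots> = ennreal (1 / norm x ^ d) * F x"
          using x by (subst hom) (simp_all add: power_one_over)
        also have "\<dots> = F x + F x * (\<integral>\<^sup>+s. ?k s * indicator {norm x..} s \<partial>lborel)"
          using x True by (subst w) (simp_all add: distrib_left mult.commute)
        finally show ?thesis using True by simp
      next
        case False
        have "(\<integral>\<^sup>+s. ?k s * indicator {norm x..} s \<partial>lborel) = (\<integral>\<^sup>+s. 0 \<partial>(lborel::real measure))"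
          by (rule nn_integral_cong_AE)
             (use AE_lborel_singleton[of "1::real"] in eventually_elim, use False in \<open>auto simp: indicator_def\<close>)
        with False show ?thesis by simp
      qed
    qed
  qed
  also have "\<dots> = ?B + (\<integral>\<^sup>+x. F x * (\<integral>\<^sup>+s. ?k s * indicator {norm x..} s \<partial>lborel) \<partial>lborel)"
  proof (rule nn_integral_add)
    have "(\<lambda>x::real^3. \<integral>\<^sup>+s. ?k s * indicator {y. norm x \<le> y} s \<partial>lborel) \<in> borel_measurable borel"
      unfolding indicator_def mem_Collect_eq by measurable
    then show "(\<lambda>x. F x * (\<integral>\<^sup>+s. ?k s * indicator {norm x..} s \<partial>lborel)) \<in> borel_measurable lborel"
      by (simp add: atLeast_def)
  qed measurable
  also have "(\<integral>\<^sup>+x. F x * (\<integral>\<^sup>+s. ?k s * indicator {norm x..} s \<partial>lborel) \<partial>lborel)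
     = (\<integral>\<^sup>+s. ?k s * ennreal (s ^ (d + DIM(real^3))) * indicator {0..} s \<partial>lborel) * ?B"
    by (rule nn_integral_layer_cake_homogeneous) (use hom in auto)
  \<comment> \<open>The powers of s cancel down to \<open>d * s\<^sup>2\<close>, whose integral over
    [0, 1] is \<open>d / 3\<close>; the ball integral itself adds the 1 in
    \<open>1 + d / 3\<close>.\<close>
  also have "(\<integral>\<^sup>+s. ?k s * ennreal (s ^ (d + DIM(real^3))) * indicator {0..} s \<partial>lborel)
      = (\<integral>\<^sup>+s. ennreal (d * s\<^sup>2) * indicator {0..1} s \<partial>lborel)"
    by (auto intro!: nn_integral_cong simp: indicator_def ennreal_mult[symmetric] power_add field_simps eval_nat_numeral)
  also have "\<dots> = ennreal (d / 3 * 1 ^ 3 - d / 3 * 0 ^ 3)"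
    by (rule nn_integral_FTC_Icc) (auto intro!: derivative_eq_intros)
  finally show ?thesis
    by (simp add: distrib_right)
qed

section \<open>Radial Gaussian moments and comparison with the sphere\<close>

lemma nn_integral_half_line_moment_6:
  "(\<integral>\<^sup>+s. ennreal (s ^ 6 * exp (- s\<^sup>2 / 2)) * indicator {0..} s \<partial>lborel) = ennreal (15 * sqrt (2 * pi) / 2)"
proof -
  have s6: "sqrt 2 ^ 6 = (8::real)"
    using power_mult[of "sqrt 2" 2 3] by simp
  \<comment> \<open>Rescaling by \<open>sqrt 2\<close> produces the weight
    \<open>exp (- s\<^sup>2)\<close> of \<open>gaussian_moment_even_pos\<close>.\<close>
  have "(\<integral>\<^sup>+s. ennreal (s ^ 6 * exp (- s\<^sup>2 / 2)) * indicator {0..} s \<partial>lborel)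
      = ennreal (sqrt 2) * (\<integral>\<^sup>+s. ennreal ((0 + sqrt 2 * s) ^ 6 * exp (- (0 + sqrt 2 * s)\<^sup>2 / 2))
           * indicator {0..} (0 + sqrt 2 * s) \<partial>lborel)"
    by (subst nn_integral_real_affine[of _ "sqrt 2" 0]) simp_all
  also have "\<dots> = ennreal (sqrt 2) * (\<integral>\<^sup>+s. 8 * ennreal (indicator {0..} s *\<^sub>R (exp (- s\<^sup>2) * s ^ (2 * 3))) \<partial>lborel)"
    by (auto intro!: arg_cong2[where f = "(*)"] nn_integral_cong
        simp: indicator_def power_mult_distrib zero_le_mult_iff s6 ennreal_mult mult_ac)
  also have "\<dots> = ennreal (sqrt 2) * (8 * ennreal (sqrt pi / 2 * (fact (2 * 3) / (2 ^ (2 * 3) * fact 3))))"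
    using gaussian_moment_even_pos[of 3]
    by (subst nn_integral_cmult, simp, subst nn_integral_eq_integral)
       (auto simp: has_bochner_integral_iff indicator_def)
  also have "\<dots> = ennreal (15 * sqrt (2 * pi) / 2)"
    by (simp add: ennreal_mult[symmetric] fact_numeral real_sqrt_mult flip: ennreal_numeral)
  finally show ?thesis .
qed

lemma nn_integral_half_line_moment_7:
  "(\<integral>\<^sup>+s. ennreal (s ^ 7 * exp (- s\<^sup>2 / 2)) * indicator {0..} s \<partial>lborel) = 48"
proof -
  \<comment> \<open>Repeated integration by parts yields this antiderivative; the constant 48 is 2 *
    4 * 6.\<close>
  let ?F = "\<lambda>s::real. - (s ^ 6 + 6 * s ^ 4 + 24 * s\<^sup>2 + 48) * exp (- s\<^sup>2 / 2)"
  have "(\<integral>\<^sup>+s. ennreal (s ^ 7 * exp (- s\<^sup>2 / 2)) * indicator {0..} s \<partial>lborel) = ennreal (0 - ?F 0)"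
  proof (rule nn_integral_FTC_atLeast)
    show "(?F has_real_derivative x ^ 7 * exp (- x\<^sup>2 / 2)) (at x)" for x :: real
      by (auto intro!: derivative_eq_intros simp: eval_nat_numeral algebra_simps)
    show "(?F \<longlongrightarrow> 0) at_top" by real_asymp
  qed auto
  then show ?thesis by simp
qed

text \<open>Both integrals of \<open>F\<close> are tied to its integral over the unit ball, which is
  eliminated here. The relation stays multiplied out, so nothing has to be cancelled in
  \<open>ennreal\<close>.\<close>

lemma nn_integral_gaussian_eq_uniform_S2:
  fixes F :: "real^3 \<Rightarrow> ennreal"
  assumes F: "F \<in> borel_measurable borel"
    and hom: "\<And>t x. t > 0 \<Longrightarrow> F (t *\<^sub>R x) = ennreal (t ^ d) * F x"
  shows "ennreal (1 + d / 3) * (\<integral>\<^sup>+x. F x * ennreal (exp (- (norm x)\<^sup>2 / 2)) \<partial>lborel)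
       = ennreal (4 * pi / 3) * (\<integral>\<^sup>+s. ennreal (s ^ (d + 4) * exp (- s\<^sup>2 / 2)) * indicator {0..} s \<partial>lborel)
         * (\<integral>\<^sup>+U. F U \<partial>uniform_S2)"
proof -
  let ?B = "\<integral>\<^sup>+x. F x * indicator (ball 0 1) x \<partial>lborel"
  let ?M = "\<integral>\<^sup>+s. ennreal (s ^ (d + 4) * exp (- s\<^sup>2 / 2)) * indicator {0..} s \<partial>lborel"
  have "(\<integral>\<^sup>+x. F x * ennreal (exp (- (norm x)\<^sup>2 / 2)) \<partial>lborel) = ?M * ?B"
    using nn_integral_gaussian_homogeneous[of F d] assms by (simp add: add.commute[of 4])
  moreover have "ennreal (4 * pi / 3) * (\<integral>\<^sup>+U. F U \<partial>uniform_S2) = ennreal (1 + d / 3) * ?B"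
    using nn_integral_uniform_S2_homogeneous[of F d] assms by blast
  ultimately show ?thesis
    by (simp only: mult.assoc mult.left_commute[of _ ?M])
qed


section \<open>Moments as integrals of characteristic functions\<close>

lemma integrable_bounded_uniform_S2:
  fixes f :: "real^3 \<Rightarrow> real"
  assumes f: "f \<in> borel_measurable borel" and bound: "\<And>U. norm U = 1 \<Longrightarrow> \<bar>f U\<bar> \<le> C"
  shows "integrable uniform_S2 f"
proof -
  interpret prob_space uniform_S2 by (rule prob_space_uniform_S2)
  show ?thesis
  proof (rule integrable_const_bound[of _ C])
    show "AE U in uniform_S2. norm (f U) \<le> C"
      using AE_uniform_S2_sphere by eventually_elim (use bound in simp)
  qed (use f in \<open>simp add: uniform_S2_def\<close>)
qed

lemma nn_integral_gaussian_pair: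
  fixes n n' :: "real^3"
  assumes n: "norm n = 1" "norm n' = 1"
  shows "(\<integral>\<^sup>+x. ennreal (\<bar>x \<bullet> n\<bar> * \<bar>x \<bullet> n'\<bar>) * ennreal (exp (- (norm x)\<^sup>2 / 2)) \<partial>lborel)
       = ennreal (6 * pi * sqrt (2 * pi) * (\<integral>U. \<bar>U \<bullet> n\<bar> * \<bar>U \<bullet> n'\<bar> \<partial>uniform_S2))"
proof -
  let ?f = "\<lambda>x. \<bar>x \<bullet> n\<bar> * \<bar>x \<bullet> n'\<bar>"
  let ?G = "\<integral>\<^sup>+x. ennreal (?f x) * ennreal (exp (- (norm x)\<^sup>2 / 2)) \<partial>lborel"
  have "integrable uniform_S2 ?f"
  proof (rule integrable_bounded_uniform_S2[where C = 1])
    fix U :: "real^3" assume "norm U = 1"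
    then have "\<bar>U \<bullet> n\<bar> \<le> 1" "\<bar>U \<bullet> n'\<bar> \<le> 1"
      using n Cauchy_Schwarz_ineq2[of U n] Cauchy_Schwarz_ineq2[of U n'] by auto
    then show "\<bar>?f U\<bar> \<le> 1" by (simp add: abs_mult mult_le_one)
  qed simp
  then have I: "(\<integral>\<^sup>+U. ennreal (?f U) \<partial>uniform_S2) = ennreal (\<integral>U. ?f U \<partial>uniform_S2)"
    by (intro nn_integral_eq_integral) auto
  have "ennreal (1 + real 2 / 3) * ?G
      = ennreal (4 * pi / 3) * (\<integral>\<^sup>+s. ennreal (s ^ (2 + 4) * exp (- s\<^sup>2 / 2)) * indicator {0..} s \<partial>lborel)
        * (\<integral>\<^sup>+U. ennreal (?f U) \<partial>uniform_S2)"
    by (rule nn_integral_gaussian_eq_uniform_S2)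
       (auto simp: abs_mult power2_eq_square ennreal_mult[symmetric] mult_ac)
  also have "(\<integral>\<^sup>+s. ennreal (s ^ (2 + 4) * exp (- s\<^sup>2 / 2)) * indicator {0..} s \<partial>lborel)
      = ennreal (15 * sqrt (2 * pi) / 2)"
    using nn_integral_half_line_moment_6 by simp
  finally have "ennreal (1 + real 2 / 3) * ?G = ennreal (4 * pi / 3 * (15 * sqrt (2 * pi) / 2) * (\<integral>U. ?f U \<partial>uniform_S2))"
    unfolding I by (simp add: ennreal_mult[symmetric] del: real_sqrt_mult)
  \<comment> \<open>\<open>3 / 5\<close> is the inverse of \<open>1 + 2 / 3\<close>; the constants
    combine to \<open>6 * pi * sqrt (2 * pi)\<close>.\<close>
  then have "ennreal (3 / 5) * (ennreal (1 + real 2 / 3) * ?G)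
     = ennreal (3 / 5) * ennreal (4 * pi / 3 * (15 * sqrt (2 * pi) / 2) * (\<integral>U. ?f U \<partial>uniform_S2))"
    by simp
  then show ?thesis
    by (simp only: mult.assoc[symmetric] ennreal_mult'[symmetric]) (simp add: ennreal_mult'[symmetric])
qed

lemma nn_integral_gaussian_triple:
  fixes n1 n2 n3 :: "real^3"
  assumes n: "norm n1 = 1" "norm n2 = 1" "norm n3 = 1"
  shows "(\<integral>\<^sup>+x. ennreal (\<bar>x \<bullet> n1\<bar> * \<bar>x \<bullet> n2\<bar> * \<bar>x \<bullet> n3\<bar>) * ennreal (exp (- (norm x)\<^sup>2 / 2)) \<partial>lborel)
       = ennreal (32 * pi * I3 n1 n2 n3)"
proof -
  let ?f = "\<lambda>x. \<bar>x \<bullet> n1\<bar> * \<bar>x \<bullet> n2\<bar> * \<bar>x \<bullet> n3\<bar>"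
  let ?G = "\<integral>\<^sup>+x. ennreal (?f x) * ennreal (exp (- (norm x)\<^sup>2 / 2)) \<partial>lborel"
  have "integrable uniform_S2 ?f"
  proof (rule integrable_bounded_uniform_S2[where C = 1])
    fix U :: "real^3" assume "norm U = 1"
    then have "\<bar>U \<bullet> n1\<bar> \<le> 1" "\<bar>U \<bullet> n2\<bar> \<le> 1" "\<bar>U \<bullet> n3\<bar> \<le> 1"
      using n Cauchy_Schwarz_ineq2[of U n1] Cauchy_Schwarz_ineq2[of U n2] Cauchy_Schwarz_ineq2[of U n3] by auto
    then show "\<bar>?f U\<bar> \<le> 1" by (simp add: abs_mult mult_le_one)
  qed simp
  then have I: "(\<integral>\<^sup>+U. ennreal (?f U) \<partial>uniform_S2) = ennreal (I3 n1 n2 n3)"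
    unfolding I3_def by (intro nn_integral_eq_integral) auto
  have "ennreal (1 + real 3 / 3) * ?G
      = ennreal (4 * pi / 3) * (\<integral>\<^sup>+s. ennreal (s ^ (3 + 4) * exp (- s\<^sup>2 / 2)) * indicator {0..} s \<partial>lborel)
        * (\<integral>\<^sup>+U. ennreal (?f U) \<partial>uniform_S2)"
    by (rule nn_integral_gaussian_eq_uniform_S2)
       (auto simp: abs_mult power3_eq_cube ennreal_mult[symmetric] mult_ac)
  also have "(\<integral>\<^sup>+s. ennreal (s ^ (3 + 4) * exp (- s\<^sup>2 / 2)) * indicator {0..} s \<partial>lborel) = ennreal 48"
    using nn_integral_half_line_moment_7 by simp
  finally have "ennreal (1 + real 3 / 3) * ?G = ennreal (4 * pi / 3 * 48 * I3 n1 n2 n3)"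
    unfolding I by (simp only: ennreal_mult'[symmetric]) (simp add: ennreal_mult'[symmetric] del: ennreal_numeral)
  \<comment> \<open>\<open>1 / 2\<close> inverts \<open>1 + 3 / 3\<close>, and
    \<open>4 * pi / 3 * 48 / 2 = 32 * pi\<close>.\<close>
  then have "ennreal (1 / 2) * (ennreal (1 + real 3 / 3) * ?G)
     = ennreal (1 / 2) * ennreal (4 * pi / 3 * 48 * I3 n1 n2 n3)"
    by simp
  then show ?thesis
    by (simp only: mult.assoc[symmetric] ennreal_mult'[symmetric]) (simp add: ennreal_mult'[symmetric])
qed

text \<open>
  \<open>gauss_char a b c\<close> is the characteristic function of a centred Gaussian triple with unit variances
  and correlations \<open>a, b, c\<close>; \<open>pair_char\<close> and \<open>triple_char\<close> are the expectations of the products of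
  \<open>1 - cos (r X\<^sub>1)\<close>, \<open>1 - cos (s X\<^sub>2)\<close> (and \<open>1 - cos (t X\<^sub>3)\<close>) for such a pair or triple.
\<close>

definition gauss_char :: "real \<Rightarrow> real \<Rightarrow> real \<Rightarrow> real \<Rightarrow> real \<Rightarrow> real \<Rightarrow> real" where
  "gauss_char a b c r s t = exp (- (r\<^sup>2 + s\<^sup>2 + t\<^sup>2 + 2 * (r * s * a + r * t * b + s * t * c)) / 2)"

text \<open>The exponent of \<open>gauss_char\<close> is minus half the squared norm of the combined
  frequency vector \<open>?v\<close>.\<close>

lemma has_bochner_integral_cos_gauss_char:
  fixes n1 n2 n3 :: "real^3"
  assumes n: "norm n1 = 1" "norm n2 = 1" "norm n3 = 1"
  shows "has_bochner_integral lborel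
      (\<lambda>x. cos (r * (x \<bullet> n1) + s * (x \<bullet> n2) + t * (x \<bullet> n3)) * exp (- (norm x)\<^sup>2 / 2))
      (sqrt (2 * pi) ^ 3 * gauss_char (n1 \<bullet> n2) (n1 \<bullet> n3) (n2 \<bullet> n3) r s t)"
proof -
  let ?v = "r *\<^sub>R n1 + s *\<^sub>R n2 + t *\<^sub>R n3"
  have nn: "n1 \<bullet> n1 = 1" "n2 \<bullet> n2 = 1" "n3 \<bullet> n3 = 1"
    using n by (simp_all add: power2_norm_eq_inner[symmetric])
  have v: "(norm ?v)\<^sup>2 = r\<^sup>2 + s\<^sup>2 + t\<^sup>2 + 2 * (r * s * (n1 \<bullet> n2) + r * t * (n1 \<bullet> n3) + s * t * (n2 \<bullet> n3))"
    unfolding power2_norm_eq_inner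
    by (simp add: inner_add_left inner_add_right nn inner_commute[of n2 n1] inner_commute[of n3 n1] inner_commute[of n3 n2]
        power2_eq_square algebra_simps)
  have x: "?v \<bullet> x = r * (x \<bullet> n1) + s * (x \<bullet> n2) + t * (x \<bullet> n3)" for x
    by (simp add: inner_add_left inner_commute[of x])
  show ?thesis
    using has_bochner_integral_cos_gaussian[of ?v] unfolding v x gauss_char_def by simp
qed

definition pair_char :: "real \<Rightarrow> real \<Rightarrow> real \<Rightarrow> real" where
  "pair_char a r s = 1 - exp (- r\<^sup>2 / 2) - exp (- s\<^sup>2 / 2) + exp (- (r\<^sup>2 + s\<^sup>2) / 2) * cosh (a * r * s)"

definition triple_char :: "real \<Rightarrow> real \<Rightarrow> real \<Rightarrow> real \<Rightarrow> real \<Rightarrow> real \<Rightarrow> real" where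
  "triple_char a b c r s t = (let Q = gauss_char a b c in
     Q 0 0 0 - Q r 0 0 - Q 0 s 0 - Q 0 0 t
     + (Q r s 0 + Q r (- s) 0) / 2 + (Q r 0 t + Q r 0 (- t)) / 2 + (Q 0 s t + Q 0 s (- t)) / 2
     - (Q r s t + Q r s (- t) + Q r (- s) t + Q r (- s) (- t)) / 4)"

lemma has_bochner_integral_pair_char:
  fixes n n' :: "real^3"
  assumes n: "norm n = 1" "norm n' = 1"
  shows "has_bochner_integral lborel
      (\<lambda>x. (1 - cos (r * (x \<bullet> n))) * (1 - cos (s * (x \<bullet> n'))) * exp (- (norm x)\<^sup>2 / 2))
      (sqrt (2 * pi) ^ 3 * pair_char (n \<bullet> n') r s)"
proof -
  \<comment> \<open>The pair is treated as a degenerate triple whose third vector repeats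
    \<open>n'\<close> and whose third frequency is 0; hence the parameters
    \<open>n \<bullet> n'\<close> twice and 1.\<close>
  let ?Q = "gauss_char (n \<bullet> n') (n \<bullet> n') 1" and ?K = "sqrt (2 * pi) ^ 3"
  let ?g = "\<lambda>r s x. cos (r * (x \<bullet> n) + s * (x \<bullet> n') + 0 * (x \<bullet> n')) * exp (- (norm x)\<^sup>2 / 2)"
  have "has_bochner_integral lborel (?g r s) (?K * ?Q r s 0)" for r s
    using has_bochner_integral_cos_gauss_char[OF n(1) n(2) n(2), of r s 0] n
    by (simp add: power2_norm_eq_inner[symmetric])
  then have "has_bochner_integral lborel (\<lambda>x. ?g 0 0 x - ?g r 0 x - ?g 0 s x + (?g r s x + ?g r (- s) x) / 2)
     (?K * ?Q 0 0 0 - ?K * ?Q r 0 0 - ?K * ?Q 0 s 0 + (?K * ?Q r s 0 + ?K * ?Q r (- s) 0) / 2)"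
    by (intro has_bochner_integral_add has_bochner_integral_diff has_bochner_integral_divide)
  moreover have "?g 0 0 x - ?g r 0 x - ?g 0 s x + (?g r s x + ?g r (- s) x) / 2
     = (1 - cos (r * (x \<bullet> n))) * (1 - cos (s * (x \<bullet> n'))) * exp (- (norm x)\<^sup>2 / 2)" for x
    by (simp add: cos_add cos_diff algebra_simps)
  moreover have "?K * ?Q 0 0 0 - ?K * ?Q r 0 0 - ?K * ?Q 0 s 0 + (?K * ?Q r s 0 + ?K * ?Q r (- s) 0) / 2
     = ?K * pair_char (n \<bullet> n') r s"
  proof -
    have "?Q r s 0 = exp (- (r\<^sup>2 + s\<^sup>2) / 2) * exp (- (n \<bullet> n' * r * s))"
         "?Q r (- s) 0 = exp (- (r\<^sup>2 + s\<^sup>2) / 2) * exp (n \<bullet> n' * r * s)"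
      unfolding gauss_char_def exp_add[symmetric] by (simp_all add: field_simps)
    moreover have "?Q 0 0 0 = 1" "?Q r 0 0 = exp (- r\<^sup>2 / 2)" "?Q 0 s 0 = exp (- s\<^sup>2 / 2)"
      by (simp_all add: gauss_char_def)
    ultimately show ?thesis
      by (simp only: pair_char_def cosh_field_def) (simp add: field_simps)
  qed
  ultimately show ?thesis by simp
qed

lemma has_bochner_integral_triple_char:
  fixes n1 n2 n3 :: "real^3"
  assumes n: "norm n1 = 1" "norm n2 = 1" "norm n3 = 1"
  shows "has_bochner_integral lborel
      (\<lambda>x. (1 - cos (r * (x \<bullet> n1))) * (1 - cos (s * (x \<bullet> n2))) * (1 - cos (t * (x \<bullet> n3))) * exp (- (norm x)\<^sup>2 / 2))
      (sqrt (2 * pi) ^ 3 * triple_char (n1 \<bullet> n2) (n1 \<bullet> n3) (n2 \<bullet> n3) r s t)"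
proof -
  let ?Q = "gauss_char (n1 \<bullet> n2) (n1 \<bullet> n3) (n2 \<bullet> n3)" and ?K = "sqrt (2 * pi) ^ 3"
  let ?g = "\<lambda>r s t x. cos (r * (x \<bullet> n1) + s * (x \<bullet> n2) + t * (x \<bullet> n3)) * exp (- (norm x)\<^sup>2 / 2)"
  \<comment> \<open>\<open>?T\<close> encodes the expansion of a product of three factors
    \<open>1 - cos\<close>, with products of cosines averaged over signs of the frequencies. Being
    linear, it applies alike to the integrands and to their integrals.\<close>
  let ?T = "\<lambda>Q. Q 0 0 0 - Q r 0 0 - Q 0 s 0 - Q 0 0 t
     + (Q r s 0 + Q r (- s) 0) / 2 + (Q r 0 t + Q r 0 (- t)) / 2 + (Q 0 s t + Q 0 s (- t)) / 2
     - (Q r s t + Q r s (- t) + Q r (- s) t + Q r (- s) (- t)) / 4"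
  have "has_bochner_integral lborel (?g r s t) (?K * ?Q r s t)" for r s t
    by (rule has_bochner_integral_cos_gauss_char[OF n])
  then have "has_bochner_integral lborel (\<lambda>x. ?T (\<lambda>r s t. ?g r s t x)) (?T (\<lambda>r s t. ?K * ?Q r s t))"
    by (intro has_bochner_integral_add has_bochner_integral_diff has_bochner_integral_divide)
  moreover have "?T (\<lambda>r s t. ?g r s t x)
     = (1 - cos (r * (x \<bullet> n1))) * (1 - cos (s * (x \<bullet> n2))) * (1 - cos (t * (x \<bullet> n3))) * exp (- (norm x)\<^sup>2 / 2)" for x
    by (simp add: cos_add sin_add cos_diff sin_diff algebra_simps)
  moreover have "?T (\<lambda>r s t. ?K * ?Q r s t) = ?K * triple_char (n1 \<bullet> n2) (n1 \<bullet> n3) (n2 \<bullet> n3) r s t"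
    unfolding triple_char_def Let_def by argo
  ultimately show ?thesis by simp
qed

text \<open>Nonnegativity is not visible from the formula; it holds because a positive multiple of
  the value is the integral of a nonnegative function. It ensures that \<open>ennreal\<close> does
  not truncate the value to 0.\<close>

lemma pair_char_nonneg:
  fixes n n' :: "real^3"
  assumes n: "norm n = 1" "norm n' = 1"
  shows "0 \<le> pair_char (n \<bullet> n') r s"
proof -
  have "0 \<le> sqrt (2 * pi) ^ 3 * pair_char (n \<bullet> n') r s"
    unfolding has_bochner_integral_integral_eq[OF has_bochner_integral_pair_char[OF n, of r s], symmetric]
    by (rule Bochner_Integration.integral_nonneg) simp
  then show ?thesis using pi_gt_zero by (auto simp: zero_le_mult_iff)
qed

lemma triple_char_nonneg:
  fixes n1 n2 n3 :: "real^3"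
  assumes n: "norm n1 = 1" "norm n2 = 1" "norm n3 = 1"
  shows "0 \<le> triple_char (n1 \<bullet> n2) (n1 \<bullet> n3) (n2 \<bullet> n3) r s t"
proof -
  have "0 \<le> sqrt (2 * pi) ^ 3 * triple_char (n1 \<bullet> n2) (n1 \<bullet> n3) (n2 \<bullet> n3) r s t"
    unfolding has_bochner_integral_integral_eq[OF has_bochner_integral_triple_char[OF n, of r s t], symmetric]
    by (rule Bochner_Integration.integral_nonneg) simp
  then show ?thesis using pi_gt_zero by (auto simp: zero_le_mult_iff)
qed

lemma nn_integral_has_bochner_integral:
  fixes f :: "'a \<Rightarrow> real"
  assumes "has_bochner_integral M f x" "\<And>x. 0 \<le> f x"
  shows "(\<integral>\<^sup>+x. ennreal (f x) \<partial>M) = ennreal x"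
  using assms by (subst nn_integral_eq_integral) (auto simp: has_bochner_integral_iff)

lemma nn_integral_one_minus_cos_mult:
  fixes x :: real
  shows "(\<integral>\<^sup>+s. ennreal ((1 - cos (s * x)) / s\<^sup>2) * c \<partial>lborel) = ennreal (pi * \<bar>x\<bar>) * c"
  by (subst nn_integral_multc) (simp_all add: nn_integral_one_minus_cos)

lemma borel_measurable_cosh [measurable]: "(cosh :: real \<Rightarrow> real) \<in> borel_measurable borel"
  by (intro borel_measurable_continuous_onI continuous_intros)

section \<open>Moments as iterated integrals over frequencies\<close>

lemma pair_moment_integral:
  fixes n n' :: "real^3"
  assumes n: "norm n = 1" "norm n' = 1"
  shows "ennreal (3 * pi\<^sup>2 * (\<integral>U. \<bar>U \<bullet> n\<bar> * \<bar>U \<bullet> n'\<bar> \<partial>uniform_S2))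
      = (\<integral>\<^sup>+r. \<integral>\<^sup>+s. ennreal (pair_char (n \<bullet> n') r s / (r\<^sup>2 * s\<^sup>2)) \<partial>lborel \<partial>lborel)"
proof -
  define K where "K = sqrt (2 * pi) ^ 3"
  have K: "K > 0" "6 * pi * sqrt (2 * pi) = 3 * K"
    by (simp_all add: K_def power3_eq_cube)
  let ?k = "\<lambda>s y. ennreal ((1 - cos (s * y)) / s\<^sup>2)"
  let ?e = "\<lambda>x::real^3. ennreal (exp (- (norm x)\<^sup>2 / 2))"
  let ?J = "\<integral>U. \<bar>U \<bullet> n\<bar> * \<bar>U \<bullet> n'\<bar> \<partial>uniform_S2"
  \<comment> \<open>Each of the two cosine representations contributes a factor \<open>pi\<close>.
    \<open>K\<close> is the Gaussian normalisation; cancelling it at the end leaves the constant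
    \<open>3 * pi\<^sup>2\<close>.\<close>
  have "ennreal K * ennreal (3 * pi\<^sup>2 * ?J) = ennreal (pi\<^sup>2) * ennreal (6 * pi * sqrt (2 * pi) * ?J)"
    using K by (simp only: K(2)) (simp add: ennreal_mult'[symmetric] mult_ac)
  also have "\<dots> = (\<integral>\<^sup>+x. ennreal (pi\<^sup>2) * (ennreal (\<bar>x \<bullet> n\<bar> * \<bar>x \<bullet> n'\<bar>) * ?e x) \<partial>lborel)"
    unfolding nn_integral_gaussian_pair[OF n, symmetric] by (rule nn_integral_cmult[symmetric]) measurable
  also have "\<dots> = (\<integral>\<^sup>+x. \<integral>\<^sup>+r. \<integral>\<^sup>+s. ?k r (x \<bullet> n) * (?k s (x \<bullet> n') * ?e x) \<partial>lborel \<partial>lborel \<partial>lborel)"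
  proof (rule nn_integral_cong)
    fix x :: "real^3"
    have "(\<integral>\<^sup>+r. \<integral>\<^sup>+s. ?k r (x \<bullet> n) * (?k s (x \<bullet> n') * ?e x) \<partial>lborel \<partial>lborel)
        = ennreal (pi * \<bar>x \<bullet> n\<bar>) * (ennreal (pi * \<bar>x \<bullet> n'\<bar>) * ?e x)"
      by (simp add: nn_integral_cmult nn_integral_one_minus_cos_mult)
    then show "ennreal (pi\<^sup>2) * (ennreal (\<bar>x \<bullet> n\<bar> * \<bar>x \<bullet> n'\<bar>) * ?e x)
       = (\<integral>\<^sup>+r. \<integral>\<^sup>+s. ?k r (x \<bullet> n) * (?k s (x \<bullet> n') * ?e x) \<partial>lborel \<partial>lborel)"
      by (simp add: ennreal_mult'[symmetric] power2_eq_square mult_ac)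
  qed
  \<comment> \<open>Two exchanges move the spatial integral innermost, where it becomes
    \<open>pair_char\<close>.\<close>
  also have "\<dots> = (\<integral>\<^sup>+r. \<integral>\<^sup>+x. \<integral>\<^sup>+s. ?k r (x \<bullet> n) * (?k s (x \<bullet> n') * ?e x) \<partial>lborel \<partial>lborel \<partial>lborel)"
    by (rule lborel_pair.Fubini') measurable
  also have "\<dots> = (\<integral>\<^sup>+r. \<integral>\<^sup>+s. \<integral>\<^sup>+x. ?k r (x \<bullet> n) * (?k s (x \<bullet> n') * ?e x) \<partial>lborel \<partial>lborel \<partial>lborel)"
    by (intro nn_integral_cong lborel_pair.Fubini') measurable
  also have "\<dots> = (\<integral>\<^sup>+r. \<integral>\<^sup>+s. ennreal K * ennreal (pair_char (n \<bullet> n') r s / (r\<^sup>2 * s\<^sup>2)) \<partial>lborel \<partial>lborel)"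
  proof (intro nn_integral_cong)
    fix r s :: real
    have "(\<integral>\<^sup>+x. ?k r (x \<bullet> n) * (?k s (x \<bullet> n') * ?e x) \<partial>lborel)
       = (\<integral>\<^sup>+x. ennreal ((1 - cos (r * (x \<bullet> n))) * (1 - cos (s * (x \<bullet> n'))) * exp (- (norm x)\<^sup>2 / 2) / (r\<^sup>2 * s\<^sup>2)) \<partial>lborel)"
      by (intro nn_integral_cong) (simp add: ennreal_mult'[symmetric])
    also have "\<dots> = ennreal (K * pair_char (n \<bullet> n') r s / (r\<^sup>2 * s\<^sup>2))"
      unfolding K_def
      by (intro nn_integral_has_bochner_integral has_bochner_integral_divide has_bochner_integral_pair_char n) simp
    finally show "(\<integral>\<^sup>+x. ?k r (x \<bullet> n) * (?k s (x \<bullet> n') * ?e x) \<partial>lborel)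
       = ennreal K * ennreal (pair_char (n \<bullet> n') r s / (r\<^sup>2 * s\<^sup>2))"
      using K by (simp add: ennreal_mult'[symmetric])
  qed
  also have "\<dots> = ennreal K * (\<integral>\<^sup>+r. \<integral>\<^sup>+s. ennreal (pair_char (n \<bullet> n') r s / (r\<^sup>2 * s\<^sup>2)) \<partial>lborel \<partial>lborel)"
    unfolding pair_char_def by (simp add: nn_integral_cmult)
  finally have "ennreal (1 / K) * (ennreal K * ennreal (3 * pi\<^sup>2 * ?J))
     = ennreal (1 / K) * (ennreal K * (\<integral>\<^sup>+r. \<integral>\<^sup>+s. ennreal (pair_char (n \<bullet> n') r s / (r\<^sup>2 * s\<^sup>2)) \<partial>lborel \<partial>lborel))"
    by simp
  then show ?thesis
    using K(1) by (simp only: mult.assoc[symmetric] ennreal_mult'[symmetric]) (simp add: ennreal_mult'[symmetric] mult.assoc)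
qed

text \<open>The argument for pairs, with a third frequency. The normalisation is kept on the right
  because \<open>I3_gap\<close> combines it with a second copy of itself.\<close>

lemma triple_moment_integral:
  fixes n1 n2 n3 :: "real^3"
  assumes n: "norm n1 = 1" "norm n2 = 1" "norm n3 = 1"
  shows "ennreal (32 * pi ^ 4 * I3 n1 n2 n3)
      = ennreal (sqrt (2 * pi) ^ 3) * (\<integral>\<^sup>+r. \<integral>\<^sup>+s. \<integral>\<^sup>+t.
          ennreal (triple_char (n1 \<bullet> n2) (n1 \<bullet> n3) (n2 \<bullet> n3) r s t / (r\<^sup>2 * s\<^sup>2 * t\<^sup>2)) \<partial>lborel \<partial>lborel \<partial>lborel)"
proof -
  define K where "K = sqrt (2 * pi) ^ 3"
  have K: "K > 0" by (simp add: K_def)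
  let ?k = "\<lambda>s y. ennreal ((1 - cos (s * y)) / s\<^sup>2)"
  let ?e = "\<lambda>x::real^3. ennreal (exp (- (norm x)\<^sup>2 / 2))"
  let ?c = "triple_char (n1 \<bullet> n2) (n1 \<bullet> n3) (n2 \<bullet> n3)"
  let ?f = "\<lambda>x r s t. ?k r (x \<bullet> n1) * (?k s (x \<bullet> n2) * (?k t (x \<bullet> n3) * ?e x))"
  have "ennreal (32 * pi ^ 4 * I3 n1 n2 n3) = ennreal (pi ^ 3) * ennreal (32 * pi * I3 n1 n2 n3)"
    by (simp add: ennreal_mult'[symmetric] eval_nat_numeral mult_ac)
  also have "\<dots> = (\<integral>\<^sup>+x. ennreal (pi ^ 3) * (ennreal (\<bar>x \<bullet> n1\<bar> * \<bar>x \<bullet> n2\<bar> * \<bar>x \<bullet> n3\<bar>) * ?e x) \<partial>lborel)"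
    unfolding nn_integral_gaussian_triple[OF n, symmetric] by (rule nn_integral_cmult[symmetric]) measurable
  also have "\<dots> = (\<integral>\<^sup>+x. \<integral>\<^sup>+r. \<integral>\<^sup>+s. \<integral>\<^sup>+t. ?f x r s t \<partial>lborel \<partial>lborel \<partial>lborel \<partial>lborel)"
  proof (rule nn_integral_cong)
    fix x :: "real^3"
    have "(\<integral>\<^sup>+r. \<integral>\<^sup>+s. \<integral>\<^sup>+t. ?f x r s t \<partial>lborel \<partial>lborel \<partial>lborel)
        = ennreal (pi * \<bar>x \<bullet> n1\<bar>) * (ennreal (pi * \<bar>x \<bullet> n2\<bar>) * (ennreal (pi * \<bar>x \<bullet> n3\<bar>) * ?e x))"
      by (simp add: nn_integral_cmult nn_integral_one_minus_cos_mult)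
    then show "ennreal (pi ^ 3) * (ennreal (\<bar>x \<bullet> n1\<bar> * \<bar>x \<bullet> n2\<bar> * \<bar>x \<bullet> n3\<bar>) * ?e x)
       = (\<integral>\<^sup>+r. \<integral>\<^sup>+s. \<integral>\<^sup>+t. ?f x r s t \<partial>lborel \<partial>lborel \<partial>lborel)"
      by (simp add: ennreal_mult'[symmetric] power3_eq_cube mult_ac)
  qed
  also have "\<dots> = (\<integral>\<^sup>+r. \<integral>\<^sup>+x. \<integral>\<^sup>+s. \<integral>\<^sup>+t. ?f x r s t \<partial>lborel \<partial>lborel \<partial>lborel \<partial>lborel)"
    by (rule lborel_pair.Fubini') measurable
  also have "\<dots> = (\<integral>\<^sup>+r. \<integral>\<^sup>+s. \<integral>\<^sup>+x. \<integral>\<^sup>+t. ?f x r s t \<partial>lborel \<partial>lborel \<partial>lborel \<partial>lborel)"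
    by (intro nn_integral_cong lborel_pair.Fubini') measurable
  also have "\<dots> = (\<integral>\<^sup>+r. \<integral>\<^sup>+s. \<integral>\<^sup>+t. \<integral>\<^sup>+x. ?f x r s t \<partial>lborel \<partial>lborel \<partial>lborel \<partial>lborel)"
    by (intro nn_integral_cong lborel_pair.Fubini') measurable
  also have "\<dots> = (\<integral>\<^sup>+r. \<integral>\<^sup>+s. \<integral>\<^sup>+t. ennreal K * ennreal (?c r s t / (r\<^sup>2 * s\<^sup>2 * t\<^sup>2)) \<partial>lborel \<partial>lborel \<partial>lborel)"
  proof (intro nn_integral_cong)
    fix r s t :: real
    have "(\<integral>\<^sup>+x. ?f x r s t \<partial>lborel)
       = (\<integral>\<^sup>+x. ennreal ((1 - cos (r * (x \<bullet> n1))) * (1 - cos (s * (x \<bullet> n2))) * (1 - cos (t * (x \<bullet> n3)))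
            * exp (- (norm x)\<^sup>2 / 2) / (r\<^sup>2 * s\<^sup>2 * t\<^sup>2)) \<partial>lborel)"
      by (intro nn_integral_cong) (simp add: ennreal_mult'[symmetric] mult.assoc)
    also have "\<dots> = ennreal (K * ?c r s t / (r\<^sup>2 * s\<^sup>2 * t\<^sup>2))"
      unfolding K_def
      by (intro nn_integral_has_bochner_integral has_bochner_integral_divide has_bochner_integral_triple_char n) simp
    finally show "(\<integral>\<^sup>+x. ?f x r s t \<partial>lborel) = ennreal K * ennreal (?c r s t / (r\<^sup>2 * s\<^sup>2 * t\<^sup>2))"
      using K by (simp add: ennreal_mult'[symmetric])
  qed
  also have "\<dots> = ennreal K * (\<integral>\<^sup>+r. \<integral>\<^sup>+s. \<integral>\<^sup>+t. ennreal (?c r s t / (r\<^sup>2 * s\<^sup>2 * t\<^sup>2)) \<partial>lborel \<partial>lborel \<partial>lborel)"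
    unfolding triple_char_def gauss_char_def Let_def by (simp add: nn_integral_cmult)
  finally show ?thesis unfolding K_def .
qed


section \<open>The triple moment\<close>

text \<open>Recording \<open>\<bar>x\<bar> \<le> \<bar>sinh x\<bar>\<close> as a factor
  \<open>h \<ge> 1\<close> covers both signs of \<open>x\<close> and the value 0 at once.\<close>

lemma sinh_eq_mult:
  fixes x :: real
  obtains h where "h \<ge> 1" "sinh x = x * h"
proof (cases "x = 0")
  case False
  have "\<bar>x\<bar> \<le> \<bar>sinh x\<bar>"
    using real_le_abs_sinh[of x] by (simp add: sinh_field_def exp_minus)
  then have "sinh x / x \<ge> 1"
    using False by (auto simp: le_divide_eq abs_if split: if_splits)
  with False show thesis by (intro that[of "sinh x / x"]) auto
qed (use that[of 1] in simp)

text \<open>Single factors may be negative, so their inequalities cannot simply be multiplied; only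
  the product has a known sign, and it is multiplied by \<open>h1 * h2 * h3 \<ge> 1\<close>.\<close>

lemma mult_le_sinh_mult:
  fixes p q u :: real
  assumes "0 \<le> p * q * u"
  shows "p * q * u \<le> sinh p * sinh q * sinh u"
proof -
  obtain h1 h2 h3 where h: "h1 \<ge> 1" "sinh p = p * h1" "h2 \<ge> 1" "sinh q = q * h2" "h3 \<ge> 1" "sinh u = u * h3"
    using sinh_eq_mult[of p] sinh_eq_mult[of q] sinh_eq_mult[of u] by metis
  have "1 \<le> h1 * h2 * h3"
    using mult_mono[of 1 "h1 * h2" 1 h3] mult_mono[of 1 h1 1 h2] h by auto
  then have "p * q * u * 1 \<le> p * q * u * (h1 * h2 * h3)"
    using assms by (rule mult_left_mono)
  also have "\<dots> = sinh p * sinh q * sinh u" by (simp add: h)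
  finally show ?thesis by simp
qed

text \<open>Terms with a vanishing frequency agree, since those in s and t alone are averaged over
  the sign of t. The eight remaining exponentials are the expansion of the product of three
  hyperbolic sines.\<close>

lemma triple_char_diff:
  "triple_char a b c r s t = triple_char a b (- c) r s t
     + 2 * exp (- (r\<^sup>2 + s\<^sup>2 + t\<^sup>2) / 2) * (sinh (a * r * s) * sinh (b * r * t) * sinh (c * s * t))"
proof -
  define e P P' Q Q' U U' where "e = exp (- (r\<^sup>2 + s\<^sup>2 + t\<^sup>2) / 2)"
    "P = exp (a * r * s)" "P' = exp (- (a * r * s))" "Q = exp (b * r * t)" "Q' = exp (- (b * r * t))"
    "U = exp (c * s * t)" "U' = exp (- (c * s * t))"
  note defs = this
  have terms:
    "gauss_char a b c r s t = e * (P' * Q' * U')" "gauss_char a b c r s (- t) = e * (P' * Q * U)"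
    "gauss_char a b c r (- s) t = e * (P * Q' * U)" "gauss_char a b c r (- s) (- t) = e * (P * Q * U')"
    "gauss_char a b (- c) r s t = e * (P' * Q' * U)" "gauss_char a b (- c) r s (- t) = e * (P' * Q * U')"
    "gauss_char a b (- c) r (- s) t = e * (P * Q' * U')" "gauss_char a b (- c) r (- s) (- t) = e * (P * Q * U)"
    unfolding gauss_char_def defs exp_add[symmetric] by (simp_all add: field_simps)
  have boundary: "gauss_char a b (- c) r' s' 0 = gauss_char a b c r' s' 0"
    "gauss_char a b (- c) r' 0 t' = gauss_char a b c r' 0 t'"
    "gauss_char a b (- c) 0 s' t' = gauss_char a b c 0 s' (- t')" for r' s' t'
    by (simp_all add: gauss_char_def)
  have "2 * e * (sinh (a * r * s) * sinh (b * r * t) * sinh (c * s * t))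
      = 2 * e * ((P - P') / 2 * ((Q - Q') / 2) * ((U - U') / 2))"
    unfolding sinh_field_def defs ..
  also have "\<dots> = (e * (P * Q * U) + e * (P * Q' * U') + e * (P' * Q * U') + e * (P' * Q' * U)
      - e * (P' * Q' * U') - e * (P' * Q * U) - e * (P * Q' * U) - e * (P * Q * U')) / 4"
    by (simp add: field_simps)
  finally show ?thesis
    unfolding triple_char_def Let_def terms boundary defs(1)[symmetric] by (linarith | argo)
qed

text \<open>At \<open>s = 0\<close> the integrand is \<open>0\<close>, not \<open>1\<close>, because of \<open>x / 0 = 0\<close>.\<close>

lemma nn_integral_gaussian_off_zero:
  "(\<integral>\<^sup>+s. ennreal (s\<^sup>2 * exp (- (s::real)\<^sup>2 / 2) / s\<^sup>2) \<partial>lborel) = ennreal (sqrt (2 * pi))"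
  unfolding nn_integral_std_gaussian[symmetric]
  by (rule nn_integral_cong_AE) (use AE_lborel_singleton[of "0::real"] in eventually_elim, simp)

lemma borel_measurable_triple_char [measurable (raw)]:
  assumes [measurable]: "f \<in> borel_measurable M" "g \<in> borel_measurable M" "h \<in> borel_measurable M"
  shows "(\<lambda>x. triple_char a b c (f x) (g x) (h x)) \<in> borel_measurable M"
  unfolding triple_char_def gauss_char_def Let_def by measurable

lemma borel_measurable_pair_char [measurable (raw)]:
  assumes [measurable]: "f \<in> borel_measurable M" "g \<in> borel_measurable M"
  shows "(\<lambda>x. pair_char a (f x) (g x)) \<in> borel_measurable M"
  unfolding pair_char_def by measurable

lemma nn_integral_product3:
  assumes [measurable]: "g \<in> borel_measurable M"
  shows "(\<integral>\<^sup>+r. \<integral>\<^sup>+s. \<integral>\<^sup>+t. C * (g r * (g s * g t)) \<partial>M \<partial>M \<partial>M)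
    = C * (integral\<^sup>N M g * (integral\<^sup>N M g * integral\<^sup>N M g))"
  by (simp add: nn_integral_cmult nn_integral_multc)

lemma I3_nonneg: "0 \<le> I3 n1 n2 n3"
  unfolding I3_def by (rule Bochner_Integration.integral_nonneg) simp

lemma I3_gap:
  fixes n1 n2 n3 m1 m2 m3 :: "real^3"
  assumes n: "norm n1 = 1" "norm n2 = 1" "norm n3 = 1" "n1 \<bullet> n2 = a" "n1 \<bullet> n3 = b" "n2 \<bullet> n3 = c"
    and m: "norm m1 = 1" "norm m2 = 1" "norm m3 = 1" "m1 \<bullet> m2 = a" "m1 \<bullet> m3 = b" "m2 \<bullet> m3 = - c"
    and pos: "0 \<le> a * b * c"
  shows "a * b * c / (2 * pi) \<le> I3 n1 n2 n3 - I3 m1 m2 m3"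
proof -
  define K where "K = sqrt (2 * pi) ^ 3"
  have K: "0 \<le> K" "K * K = 8 * pi ^ 3"
  proof -
    have "K * K = (sqrt (2 * pi) * sqrt (2 * pi)) ^ 3"
      unfolding K_def power_mult_distrib ..
    then show "K * K = 8 * pi ^ 3" by (simp add: power_mult_distrib)
  qed (simp add: K_def)
  \<comment> \<open>The factor \<open>s\<^sup>2 / s\<^sup>2\<close> is kept: it vanishes at 0 as the
    integrand does, so the pointwise bound holds also where a frequency is 0.\<close>
  let ?w = "\<lambda>s::real. s\<^sup>2 * exp (- s\<^sup>2 / 2) / s\<^sup>2"
  let ?f = "\<lambda>c r s t. triple_char a b c r s t / (r\<^sup>2 * s\<^sup>2 * t\<^sup>2)"
  \<comment> \<open>The bound is additive, which avoids subtraction in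
    \<open>ennreal\<close>.\<close>
  have le: "ennreal (?f (- c) r s t) + ennreal (2 * (a * b * c)) * (ennreal (?w r) * (ennreal (?w s) * ennreal (?w t)))
     \<le> ennreal (?f c r s t)" for r s t
  proof -
    have nonneg: "0 \<le> triple_char a b (- c) r s t"
      using triple_char_nonneg[of m1 m2 m3 r s t] m by simp
    have *: "(a * r * s) * (b * r * t) * (c * s * t) = a * b * c * (r * s * t)\<^sup>2"
      by (simp add: power2_eq_square)
    have "triple_char a b (- c) r s t + 2 * (a * b * c) * (r\<^sup>2 * s\<^sup>2 * t\<^sup>2 * exp (- (r\<^sup>2 + s\<^sup>2 + t\<^sup>2) / 2))
        = triple_char a b (- c) r s t + 2 * exp (- (r\<^sup>2 + s\<^sup>2 + t\<^sup>2) / 2) * ((a * r * s) * (b * r * t) * (c * s * t))"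
      unfolding * by (simp add: power_mult_distrib)
    also have "\<dots> \<le> triple_char a b c r s t"
      unfolding triple_char_diff[of a b c r s t]
      by (intro add_left_mono mult_left_mono mult_le_sinh_mult) (simp_all only: *, simp_all add: pos)
    finally have "?f (- c) r s t + 2 * (a * b * c) * (r\<^sup>2 * s\<^sup>2 * t\<^sup>2 * exp (- (r\<^sup>2 + s\<^sup>2 + t\<^sup>2) / 2)) / (r\<^sup>2 * s\<^sup>2 * t\<^sup>2)
        \<le> ?f c r s t"
      unfolding add_divide_distrib[symmetric] by (rule divide_right_mono) simp
    also have "exp (- (r\<^sup>2 + s\<^sup>2 + t\<^sup>2) / 2) = exp (- r\<^sup>2 / 2) * (exp (- s\<^sup>2 / 2) * exp (- t\<^sup>2 / 2))"
      unfolding exp_add[symmetric] by (simp add: field_simps)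
    also have "2 * (a * b * c) * (r\<^sup>2 * s\<^sup>2 * t\<^sup>2 * (exp (- r\<^sup>2 / 2) * (exp (- s\<^sup>2 / 2) * exp (- t\<^sup>2 / 2)))) / (r\<^sup>2 * s\<^sup>2 * t\<^sup>2)
        = 2 * (a * b * c) * (?w r * (?w s * ?w t))"
      by (cases "r = 0 \<or> s = 0 \<or> t = 0") auto
    finally have "?f (- c) r s t + 2 * (a * b * c) * (?w r * (?w s * ?w t)) \<le> ?f c r s t" .
    then have "ennreal (?f (- c) r s t + 2 * (a * b * c) * (?w r * (?w s * ?w t))) \<le> ennreal (?f c r s t)"
      by (rule ennreal_leI)
    also have "ennreal (?f (- c) r s t + 2 * (a * b * c) * (?w r * (?w s * ?w t)))
        = ennreal (?f (- c) r s t) + ennreal (2 * (a * b * c)) * (ennreal (?w r) * (ennreal (?w s) * ennreal (?w t)))"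
      using nonneg pos by (subst ennreal_plus) (simp_all add: ennreal_mult'[symmetric] ennreal_mult''[symmetric])
    finally show ?thesis .
  qed
  let ?A = "\<lambda>c. \<integral>\<^sup>+r. \<integral>\<^sup>+s. \<integral>\<^sup>+t. ennreal (?f c r s t) \<partial>lborel \<partial>lborel \<partial>lborel"
  let ?W = "\<lambda>r s t. ennreal (2 * (a * b * c)) * (ennreal (?w r) * (ennreal (?w s) * ennreal (?w t)))"
  have "(\<integral>\<^sup>+r. \<integral>\<^sup>+s. \<integral>\<^sup>+t. ?W r s t \<partial>lborel \<partial>lborel \<partial>lborel)
      = ennreal (2 * (a * b * c)) * (ennreal (sqrt (2 * pi)) * (ennreal (sqrt (2 * pi)) * ennreal (sqrt (2 * pi))))"
    unfolding nn_integral_gaussian_off_zero[symmetric] by (rule nn_integral_product3) simp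
  also have "\<dots> = ennreal (2 * (a * b * c) * K)"
    using pos by (simp add: K_def ennreal_mult'[symmetric] ennreal_mult''[symmetric] power3_eq_cube mult_ac)
  finally have W: "(\<integral>\<^sup>+r. \<integral>\<^sup>+s. \<integral>\<^sup>+t. ?W r s t \<partial>lborel \<partial>lborel \<partial>lborel) = ennreal (2 * (a * b * c) * K)" .
  have "?A (- c) + ennreal (2 * (a * b * c) * K)
      = (\<integral>\<^sup>+r. \<integral>\<^sup>+s. \<integral>\<^sup>+t. ennreal (?f (- c) r s t) + ?W r s t \<partial>lborel \<partial>lborel \<partial>lborel)"
    unfolding W[symmetric] by (simp add: nn_integral_add)
  also have "\<dots> \<le> ?A c"
    by (intro nn_integral_mono le)
  finally have "ennreal K * (?A (- c) + ennreal (2 * (a * b * c) * K)) \<le> ennreal K * ?A c"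
    by (rule mult_left_mono) simp
  moreover have "ennreal (32 * pi ^ 4 * I3 n1 n2 n3) = ennreal K * ?A c"
    using triple_moment_integral[OF n(1-3)] by (simp add: K_def n)
  moreover have "ennreal (32 * pi ^ 4 * I3 m1 m2 m3) = ennreal K * ?A (- c)"
    using triple_moment_integral[OF m(1-3)] by (simp add: K_def m)
  ultimately have "ennreal (32 * pi ^ 4 * I3 m1 m2 m3) + ennreal K * ennreal (2 * (a * b * c) * K) \<le> ennreal (32 * pi ^ 4 * I3 n1 n2 n3)"
    by (simp add: distrib_left)
  then have "32 * pi ^ 4 * I3 m1 m2 m3 + K * (2 * (a * b * c) * K) \<le> 32 * pi ^ 4 * I3 n1 n2 n3"
    using K(1) pos by (simp add: ennreal_mult'[symmetric] ennreal_plus[symmetric] I3_nonneg del: ennreal_plus)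
  \<comment> \<open>By \<open>K * K = 8 * pi ^ 3\<close> the gain is
    \<open>16 * pi ^ 3 * (a * b * c)\<close>; set against \<open>32 * pi ^ 4\<close> it yields the
    factor \<open>1 / (2 * pi)\<close>.\<close>
  also have "K * (2 * (a * b * c) * K) = 16 * pi ^ 3 * (a * b * c)"
    using K(2) by (simp add: algebra_simps)
  finally have "16 * pi ^ 3 * (a * b * c) \<le> 16 * pi ^ 3 * (2 * pi * (I3 n1 n2 n3 - I3 m1 m2 m3))"
    by (simp add: algebra_simps eval_nat_numeral)
  then have "a * b * c \<le> 2 * pi * (I3 n1 n2 n3 - I3 m1 m2 m3)"
    by (subst (asm) mult_le_cancel_left_pos) auto
  then show ?thesis by (simp add: field_simps)
qed

section \<open>Gram matrices and their realization\<close>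

text \<open>The frequency integral involves the vectors only through their inner products. This
  makes the definite description in \<open>I3_of_gram\<close> meaningful.\<close>

lemma I3_cong_gram:
  fixes n1 n2 n3 m1 m2 m3 :: "real^3"
  assumes n: "norm n1 = 1" "norm n2 = 1" "norm n3 = 1"
    and m: "norm m1 = 1" "norm m2 = 1" "norm m3 = 1"
    and eq: "n1 \<bullet> n2 = m1 \<bullet> m2" "n1 \<bullet> n3 = m1 \<bullet> m3" "n2 \<bullet> n3 = m2 \<bullet> m3"
  shows "I3 n1 n2 n3 = I3 m1 m2 m3"
proof -
  have "ennreal (32 * pi ^ 4 * I3 n1 n2 n3) = ennreal (32 * pi ^ 4 * I3 m1 m2 m3)"
    unfolding triple_moment_integral[OF n] triple_moment_integral[OF m] eq ..
  then show ?thesis by (simp add: I3_nonneg)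
qed

lemma gram3_eq_G_plus_iff:
  assumes "norm n1 = 1" "norm n2 = 1" "norm n3 = 1"
  shows "gram3 n1 n2 n3 = G_plus a b c \<longleftrightarrow> n1 \<bullet> n2 = a \<and> n1 \<bullet> n3 = b \<and> n2 \<bullet> n3 = c"
  using assms
  by (auto simp: gram3_def G_plus_def vec_eq_iff forall_3 power2_norm_eq_inner[symmetric] inner_commute)

lemma I3_of_gram_G_plus:
  assumes "norm n1 = 1" "norm n2 = 1" "norm n3 = 1"
  shows "I3_of_gram (G_plus (n1 \<bullet> n2) (n1 \<bullet> n3) (n2 \<bullet> n3)) = I3 n1 n2 n3"
  unfolding I3_of_gram_def
proof (rule the_equality)
  show "\<forall>m1\<in>sphere 0 1. \<forall>m2\<in>sphere 0 1. \<forall>m3\<in>sphere 0 1.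
     gram3 m1 m2 m3 = G_plus (n1 \<bullet> n2) (n1 \<bullet> n3) (n2 \<bullet> n3) \<longrightarrow> I3 m1 m2 m3 = I3 n1 n2 n3"
    using assms by (auto simp: gram3_eq_G_plus_iff intro!: I3_cong_gram)
next
  fix v assume "\<forall>m1\<in>sphere 0 1. \<forall>m2\<in>sphere 0 1. \<forall>m3\<in>sphere 0 1.
     gram3 m1 m2 m3 = G_plus (n1 \<bullet> n2) (n1 \<bullet> n3) (n2 \<bullet> n3) \<longrightarrow> I3 m1 m2 m3 = v"
  then show "v = I3 n1 n2 n3"
    using assms by (auto simp: gram3_eq_G_plus_iff)
qed

text \<open>Cholesky factorisation: the vectors are the rows of a lower triangular factor.
  Semidefiniteness enters through the determinant \<open>D\<close>, and
  \<open>\<bar>a\<bar> < 1\<close> makes the second pivot \<open>\<alpha>\<close> nonzero.\<close>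

lemma pos_semidef_G_plus_realizable:
  assumes a: "\<bar>a\<bar> < 1" and psd: "pos_semidef (G_plus a b c)"
  obtains n1 n2 n3 :: "real^3" where "norm n1 = 1" "norm n2 = 1" "norm n3 = 1"
    "n1 \<bullet> n2 = a" "n1 \<bullet> n3 = b" "n2 \<bullet> n3 = c"
proof -
  define \<alpha> where "\<alpha> = sqrt (1 - a\<^sup>2)"
  have "a\<^sup>2 < 1" using a by (simp add: abs_square_less_1)
  then have \<alpha>: "\<alpha> > 0" "\<alpha>\<^sup>2 = 1 - a\<^sup>2" by (simp_all add: \<alpha>_def)
  define D where "D = 1 + 2 * a * b * c - a\<^sup>2 - b\<^sup>2 - c\<^sup>2"
  \<comment> \<open>The last column of the adjugate of the matrix is mapped to \<open>D\<close> times the last unit vector.\<close>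
  define x :: "real^3" where "x = vector [a * c - b, a * b - c, 1 - a\<^sup>2]"
  have "x \<bullet> (G_plus a b c *v x) = (1 - a\<^sup>2) * D"
    by (simp add: x_def D_def G_plus_def inner_vec_def matrix_vector_mult_def sum_3 power2_eq_square algebra_simps)
  then have "0 \<le> (1 - a\<^sup>2) * D"
    using psd by (metis pos_semidef_def)
  with \<open>a\<^sup>2 < 1\<close> have D: "0 \<le> D" by (simp add: zero_le_mult_iff)
  let ?n1 = "vector [1, 0, 0] :: real^3"
  let ?n2 = "vector [a, \<alpha>, 0] :: real^3"
  let ?n3 = "vector [b, (c - a * b) / \<alpha>, sqrt D / \<alpha>] :: real^3"
  have n3: "b\<^sup>2 + ((c - a * b) / \<alpha>)\<^sup>2 + (sqrt D / \<alpha>)\<^sup>2 = 1"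
  proof -
    have "((c - a * b) / \<alpha>)\<^sup>2 + (sqrt D / \<alpha>)\<^sup>2 = ((c - a * b)\<^sup>2 + D) / (1 - a\<^sup>2)"
      using D by (simp add: power_divide \<alpha>(2) add_divide_distrib)
    also have "(c - a * b)\<^sup>2 + D = (1 - b\<^sup>2) * (1 - a\<^sup>2)"
      by (simp add: D_def power2_eq_square algebra_simps)
    finally show ?thesis using \<open>a\<^sup>2 < 1\<close> by simp
  qed
  show thesis
  proof (rule that[of ?n1 ?n2 ?n3])
    show "norm ?n1 = 1" "norm ?n2 = 1" "norm ?n3 = 1"
      using n3 \<alpha>(2) by (simp_all add: norm_eq_sqrt_inner inner_vec_def sum_3 flip: power2_eq_square)
    show "?n1 \<bullet> ?n2 = a" "?n1 \<bullet> ?n3 = b" "?n2 \<bullet> ?n3 = c"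
      using \<alpha>(1) by (simp_all add: inner_vec_def sum_3)
  qed
qed

lemma J_gap:
  assumes "0 < a" "a < 1" "0 < b" "0 < c"
    and plus: "pos_semidef (G_plus a b c)" and minus: "pos_semidef (G_minus a b c)"
  shows "a * b * c / (2 * pi) \<le> J_plus a b c - J_minus a b c"
proof -
  \<comment> \<open>Negating \<open>c\<close> brings the second matrix into the first family, so one
    realization result serves both.\<close>
  have G_minus: "G_minus a b c = G_plus a b (- c)"
    by (simp add: G_minus_def G_plus_def)
  have a: "\<bar>a\<bar> < 1" using assms by simp
  obtain n1 n2 n3 :: "real^3" where n: "norm n1 = 1" "norm n2 = 1" "norm n3 = 1"
    "n1 \<bullet> n2 = a" "n1 \<bullet> n3 = b" "n2 \<bullet> n3 = c"
    using pos_semidef_G_plus_realizable[OF a plus] .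
  obtain m1 m2 m3 :: "real^3" where m: "norm m1 = 1" "norm m2 = 1" "norm m3 = 1"
    "m1 \<bullet> m2 = a" "m1 \<bullet> m3 = b" "m2 \<bullet> m3 = - c"
    using pos_semidef_G_plus_realizable[OF a minus[unfolded G_minus]] .
  have "J_plus a b c = I3 n1 n2 n3" "J_minus a b c = I3 m1 m2 m3"
    using I3_of_gram_G_plus[OF n(1-3)] I3_of_gram_G_plus[OF m(1-3)]
    by (simp_all add: J_plus_def J_minus_def G_minus n m)
  then show ?thesis
    using I3_gap[OF n m] assms by simp
qed

section \<open>The pair moment\<close>

text \<open>Convexity puts \<open>cosh\<close> above its tangent at
  \<open>y * \<bar>z\<bar>\<close>, whose slope is at least
  \<open>sinh (\<eta> * \<bar>z\<bar>)\<close>. Evenness in \<open>z\<close> of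
  \<open>cosh (x * z)\<close> and \<open>z * sinh (\<eta> * z)\<close> removes the absolute
  value.\<close>

lemma cosh_diff_ge:
  fixes x y z \<eta> :: real
  assumes "0 \<le> \<eta>" "\<eta> \<le> y" "y \<le> x"
  shows "(x - y) * (z * sinh (\<eta> * z)) \<le> cosh (x * z) - cosh (y * z)"
proof -
  let ?z = "\<bar>z\<bar>"
  have "convex_on UNIV (cosh :: real \<Rightarrow> real)"
    by (rule convex_on_realI[where f' = sinh]) (auto intro!: derivative_eq_intros)
  moreover have cosh_der: "(cosh has_real_derivative sinh w) (at w)" for w :: real
    by (auto intro!: derivative_eq_intros)
  ultimately have "cosh (y * ?z) + sinh (y * ?z) * (x * ?z - y * ?z) \<le> cosh (x * ?z)"
    using convex_on_imp_above_tangent[of UNIV cosh "y * ?z" "x * ?z" "sinh (y * ?z)"]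
    by (simp add: cosh_der)
  moreover have "(x - y) * ?z * sinh (\<eta> * ?z) \<le> (x - y) * ?z * sinh (y * ?z)"
    using assms by (intro mult_left_mono) (auto intro: mult_right_mono)
  moreover have "z * sinh (\<eta> * z) = ?z * sinh (\<eta> * ?z)"
    by (cases "z \<ge> 0") (auto simp: abs_if)
  moreover have cosh_abs: "cosh (w * z) = cosh (w * ?z)" for w
    by (cases "z \<ge> 0") (auto simp: abs_if)
  ultimately show ?thesis
    unfolding cosh_abs[of x] cosh_abs[of y] by (simp only: algebra_simps)
qed

text \<open>Used with \<open>z = r * s\<close>: the lower bound of \<open>cosh_diff_ge\<close>,
  divided by \<open>z\<^sup>2\<close>, becomes an integral of exponentials without a singular
  denominator.\<close>

lemma nn_integral_exp_Icc:
  fixes z \<eta> :: real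
  assumes "z \<noteq> 0" "0 \<le> \<eta>"
  shows "(\<integral>\<^sup>+u. ennreal (exp (u * z)) * indicator {- \<eta>..\<eta>} u \<partial>lborel) = ennreal (2 * (z * sinh (\<eta> * z)) / z\<^sup>2)"
proof -
  have "(\<integral>\<^sup>+u. ennreal (exp (u * z)) * indicator {- \<eta>..\<eta>} u \<partial>lborel)
      = ennreal (exp (\<eta> * z) / z - exp (- \<eta> * z) / z)"
    by (rule nn_integral_FTC_Icc[where F = "\<lambda>u. exp (u * z) / z"])
       (use assms in \<open>auto intro!: derivative_eq_intros\<close>)
  also have "exp (\<eta> * z) / z - exp (- \<eta> * z) / z = 2 * (z * sinh (\<eta> * z)) / z\<^sup>2"
    using assms by (simp add: sinh_field_def power2_eq_square field_simps)
  finally show ?thesis .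
qed

text \<open>With u outermost, the inner integral is that of a bivariate Gaussian whose precision
  matrix has determinant \<open>1 - u\<^sup>2\<close>; its value is \<open>2 * pi\<close> times the
  derivative of \<open>arcsin\<close>. The condition \<open>\<eta> < 1\<close> keeps u away from the
  singularities of that derivative.\<close>

lemma nn_integral_bivariate_gaussian_arcsin:
  fixes \<eta> :: real
  assumes \<eta>: "0 \<le> \<eta>" "\<eta> < 1"
  shows "(\<integral>\<^sup>+r. \<integral>\<^sup>+s. \<integral>\<^sup>+u. ennreal (exp (- (r\<^sup>2 + s\<^sup>2) / 2)) * (ennreal (exp (u * (r * s))) * indicator {- \<eta>..\<eta>} u)
            \<partial>lborel \<partial>lborel \<partial>lborel) = ennreal (4 * pi * arcsin \<eta>)"
proof -
  let ?f = "\<lambda>r s u. ennreal (exp (- (r\<^sup>2 + s\<^sup>2) / 2)) * (ennreal (exp (u * (r * s))) * indicator {- \<eta>..\<eta>} u)"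
  have "(\<integral>\<^sup>+r. \<integral>\<^sup>+s. \<integral>\<^sup>+u. ?f r s u \<partial>lborel \<partial>lborel \<partial>lborel) = (\<integral>\<^sup>+r. \<integral>\<^sup>+u. \<integral>\<^sup>+s. ?f r s u \<partial>lborel \<partial>lborel \<partial>lborel)"
    by (intro nn_integral_cong lborel_pair.Fubini') measurable
  also have "\<dots> = (\<integral>\<^sup>+u. \<integral>\<^sup>+r. \<integral>\<^sup>+s. ?f r s u \<partial>lborel \<partial>lborel \<partial>lborel)"
    by (intro lborel_pair.Fubini') measurable
  also have "\<dots> = (\<integral>\<^sup>+u. ennreal (2 * pi / sqrt (1 - u\<^sup>2)) * indicator {- \<eta>..\<eta>} u \<partial>lborel)"
  proof (rule nn_integral_cong)
    fix u :: real
    show "(\<integral>\<^sup>+r. \<integral>\<^sup>+s. ?f r s u \<partial>lborel \<partial>lborel) = ennreal (2 * pi / sqrt (1 - u\<^sup>2)) * indicator {- \<eta>..\<eta>} u"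
    proof (cases "u \<in> {- \<eta>..\<eta>}")
      case True
      then have "\<bar>u\<bar> < 1" using \<eta> by auto
      then have u: "u\<^sup>2 < 1" by (simp add: abs_square_less_1)
      have "(\<integral>\<^sup>+s. ?f r s u \<partial>lborel) = ennreal (sqrt (2 * pi)) * ennreal (exp (0 * r - (1 - u\<^sup>2) * r\<^sup>2 / 2))" for r
      proof -
        have "(\<integral>\<^sup>+s. ?f r s u \<partial>lborel)
            = (\<integral>\<^sup>+s. ennreal (exp (- r\<^sup>2 / 2)) * ennreal (exp ((u * r) * s - 1 * s\<^sup>2 / 2)) \<partial>lborel)"
          using True by (intro nn_integral_cong)
            (simp add: ennreal_mult'[symmetric] exp_add[symmetric] field_simps)
        also have "\<dots> = ennreal (exp (- r\<^sup>2 / 2)) * ennreal (sqrt (2 * pi / 1) * exp ((u * r)\<^sup>2 / (2 * 1)))"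
          by (subst nn_integral_cmult, simp, subst nn_integral_exp_quadratic) simp_all
        also have "\<dots> = ennreal (sqrt (2 * pi) * (exp (- r\<^sup>2 / 2) * exp ((u * r)\<^sup>2 / 2)))"
          by (simp add: ennreal_mult'[symmetric] mult_ac)
        also have "exp (- r\<^sup>2 / 2) * exp ((u * r)\<^sup>2 / 2) = exp (0 * r - (1 - u\<^sup>2) * r\<^sup>2 / 2)"
          unfolding exp_add[symmetric] by (simp add: power_mult_distrib field_simps)
        finally show ?thesis by (simp add: ennreal_mult')
      qed
      then have "(\<integral>\<^sup>+r. \<integral>\<^sup>+s. ?f r s u \<partial>lborel \<partial>lborel)
          = (\<integral>\<^sup>+r. ennreal (sqrt (2 * pi)) * ennreal (exp (0 * r - (1 - u\<^sup>2) * r\<^sup>2 / 2)) \<partial>lborel)"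
        by (simp only:)
      also have "\<dots> = ennreal (sqrt (2 * pi)) * ennreal (sqrt (2 * pi / (1 - u\<^sup>2)) * exp (0\<^sup>2 / (2 * (1 - u\<^sup>2))))"
        using u by (subst nn_integral_cmult, simp, subst nn_integral_exp_quadratic) simp_all
      also have "\<dots> = ennreal (2 * pi / sqrt (1 - u\<^sup>2))"
        by (simp add: ennreal_mult'[symmetric] real_sqrt_divide)
      finally show ?thesis using True by simp
    qed simp
  qed
  also have "\<dots> = (\<integral>\<^sup>+u. ennreal (2 * pi) * (ennreal (inverse (sqrt (1 - u\<^sup>2))) * indicator {- \<eta>..\<eta>} u) \<partial>lborel)"
    by (auto intro!: nn_integral_cong simp: ennreal_mult'[symmetric] indicator_def divide_inverse)
  also have "\<dots> = ennreal (2 * pi) * (\<integral>\<^sup>+u. ennreal (inverse (sqrt (1 - u\<^sup>2))) * indicator {- \<eta>..\<eta>} u \<partial>lborel)"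
    by (rule nn_integral_cmult) simp
  also have "(\<integral>\<^sup>+u. ennreal (inverse (sqrt (1 - u\<^sup>2))) * indicator {- \<eta>..\<eta>} u \<partial>lborel) = ennreal (arcsin \<eta> - arcsin (- \<eta>))"
  proof (rule nn_integral_FTC_Icc[where F = arcsin])
    fix u assume "u \<in> {- \<eta>..\<eta>}"
    then show "(arcsin has_real_derivative inverse (sqrt (1 - u\<^sup>2))) (at u)"
      using \<eta> by (intro DERIV_arcsin) auto
    have "\<bar>u\<bar> < 1" using \<open>u \<in> {- \<eta>..\<eta>}\<close> \<eta> by auto
    then show "0 \<le> inverse (sqrt (1 - u\<^sup>2))" by (simp add: abs_square_le_1)
  qed (use \<eta> in auto)
  also have "ennreal (2 * pi) * ennreal (arcsin \<eta> - arcsin (- \<eta>)) = ennreal (4 * pi * arcsin \<eta>)"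
    using \<eta> by (simp add: ennreal_mult'[symmetric] arcsin_minus mult.assoc)
  finally show ?thesis .
qed

lemma pair_moment_gap:
  fixes n n' m m' :: "real^3"
  assumes n: "norm n = 1" "norm n' = 1" "n \<bullet> n' = a"
    and m: "norm m = 1" "norm m' = 1" "m \<bullet> m' = a'"
    and a: "0 \<le> \<eta>" "\<eta> < 1" "\<eta> \<le> a'" "a' \<le> a"
  shows "(a - a') * (2 * arcsin \<eta>) / (3 * pi)
     \<le> (\<integral>U. \<bar>U \<bullet> n\<bar> * \<bar>U \<bullet> n'\<bar> \<partial>uniform_S2) - (\<integral>U. \<bar>U \<bullet> m\<bar> * \<bar>U \<bullet> m'\<bar> \<partial>uniform_S2)"
proof -
  let ?J = "\<lambda>n n'. \<integral>U. \<bar>U \<bullet> n\<bar> * \<bar>U \<bullet> n'\<bar> \<partial>uniform_S2"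
  have J: "0 \<le> ?J n n'" for n n' :: "real^3"
    by (rule Bochner_Integration.integral_nonneg) simp
  let ?f = "\<lambda>a r s. pair_char a r s / (r\<^sup>2 * s\<^sup>2)"
  let ?e = "\<lambda>r s u. ennreal (exp (- (r\<^sup>2 + s\<^sup>2) / 2)) * (ennreal (exp (u * (r * s))) * indicator {- \<eta>..\<eta>} u)"
  \<comment> \<open>The half compensates the factor 2 in \<open>nn_integral_exp_Icc\<close>.\<close>
  let ?d = "ennreal ((a - a') / 2)"
  \<comment> \<open>Both frequencies must be nonzero: on the axes the convention
    \<open>x / 0 = 0\<close> makes the right side vanish, while the added term on the left need not.
    The axes are discarded below as null sets.\<close>
  have le: "ennreal (?f a' r s) + ?d * (\<integral>\<^sup>+u. ?e r s u \<partial>lborel) \<le> ennreal (?f a r s)" if rs: "r \<noteq> 0" "s \<noteq> 0" for r s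
  proof -
    have nonneg: "0 \<le> pair_char a' r s"
      using pair_char_nonneg[of m m' r s] m by simp
    have z: "0 \<le> z * sinh (\<eta> * z)" for z
      using a(1) by (auto simp: zero_le_mult_iff mult_le_0_iff)
    have "(\<integral>\<^sup>+u. ?e r s u \<partial>lborel)
        = ennreal (exp (- (r\<^sup>2 + s\<^sup>2) / 2)) * ennreal (2 * (r * s * sinh (\<eta> * (r * s))) / (r * s)\<^sup>2)"
      using rs a by (subst nn_integral_cmult) (simp_all add: nn_integral_exp_Icc)
    then have "?d * (\<integral>\<^sup>+u. ?e r s u \<partial>lborel)
        = ennreal (exp (- (r\<^sup>2 + s\<^sup>2) / 2) * ((a - a') * (r * s * sinh (\<eta> * (r * s)))) / (r\<^sup>2 * s\<^sup>2))"
      using a z[of "r * s"] by (simp add: ennreal_mult'[symmetric] ennreal_mult''[symmetric] power_mult_distrib mult_ac)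
    also have "\<dots> \<le> ennreal (exp (- (r\<^sup>2 + s\<^sup>2) / 2) * (cosh (a * (r * s)) - cosh (a' * (r * s))) / (r\<^sup>2 * s\<^sup>2))"
      using a by (intro ennreal_leI divide_right_mono mult_left_mono cosh_diff_ge) auto
    finally have "ennreal (?f a' r s) + ?d * (\<integral>\<^sup>+u. ?e r s u \<partial>lborel)
        \<le> ennreal (?f a' r s) + ennreal (exp (- (r\<^sup>2 + s\<^sup>2) / 2) * (cosh (a * (r * s)) - cosh (a' * (r * s))) / (r\<^sup>2 * s\<^sup>2))"
      by (rule add_left_mono)
    also have "\<dots> = ennreal (?f a' r s + exp (- (r\<^sup>2 + s\<^sup>2) / 2) * (cosh (a * (r * s)) - cosh (a' * (r * s))) / (r\<^sup>2 * s\<^sup>2))"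
    proof (rule ennreal_plus[symmetric])
      have "0 \<le> (a - a') * (r * s * sinh (\<eta> * (r * s)))"
        using a z[of "r * s"] by simp
      also have "\<dots> \<le> cosh (a * (r * s)) - cosh (a' * (r * s))"
        using a by (intro cosh_diff_ge)
      finally show "0 \<le> exp (- (r\<^sup>2 + s\<^sup>2) / 2) * (cosh (a * (r * s)) - cosh (a' * (r * s))) / (r\<^sup>2 * s\<^sup>2)"
        by simp
    qed (use nonneg in simp)
    also have "?f a' r s + exp (- (r\<^sup>2 + s\<^sup>2) / 2) * (cosh (a * (r * s)) - cosh (a' * (r * s))) / (r\<^sup>2 * s\<^sup>2) = ?f a r s"
      unfolding pair_char_def add_divide_distrib[symmetric] by (simp add: algebra_simps)
    finally show ?thesis .
  qed
  let ?A = "\<lambda>a. \<integral>\<^sup>+r. \<integral>\<^sup>+s. ennreal (?f a r s) \<partial>lborel \<partial>lborel"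
  have "?A a' + ?d * ennreal (4 * pi * arcsin \<eta>)
      = (\<integral>\<^sup>+r. \<integral>\<^sup>+s. ennreal (?f a' r s) + ?d * (\<integral>\<^sup>+u. ?e r s u \<partial>lborel) \<partial>lborel \<partial>lborel)"
    unfolding nn_integral_bivariate_gaussian_arcsin[OF a(1,2), symmetric]
    by (simp add: nn_integral_add nn_integral_cmult)
  also have "\<dots> \<le> ?A a"
  proof (intro nn_integral_mono_AE)
    show "AE r in lborel. (\<integral>\<^sup>+s. ennreal (?f a' r s) + ?d * (\<integral>\<^sup>+u. ?e r s u \<partial>lborel) \<partial>lborel)
        \<le> (\<integral>\<^sup>+s. ennreal (?f a r s) \<partial>lborel)"
      using AE_lborel_singleton[of "0::real"]
    proof eventually_elim
      fix r :: real assume r: "r \<noteq> 0"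
      show "(\<integral>\<^sup>+s. ennreal (?f a' r s) + ?d * (\<integral>\<^sup>+u. ?e r s u \<partial>lborel) \<partial>lborel)
        \<le> (\<integral>\<^sup>+s. ennreal (?f a r s) \<partial>lborel)"
      proof (intro nn_integral_mono_AE)
        show "AE s in lborel. ennreal (?f a' r s) + ?d * (\<integral>\<^sup>+u. ?e r s u \<partial>lborel) \<le> ennreal (?f a r s)"
          using AE_lborel_singleton[of "0::real"] by eventually_elim (rule le[OF r])
      qed
    qed
  qed
  finally have "?A a' + ?d * ennreal (4 * pi * arcsin \<eta>) \<le> ?A a" .
  moreover have "ennreal (3 * pi\<^sup>2 * ?J n n') = ?A a" "ennreal (3 * pi\<^sup>2 * ?J m m') = ?A a'"
    using pair_moment_integral[OF n(1,2)] pair_moment_integral[OF m(1,2)] by (simp_all only: n m)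
  ultimately have "ennreal (3 * pi\<^sup>2 * ?J m m') + ?d * ennreal (4 * pi * arcsin \<eta>) \<le> ennreal (3 * pi\<^sup>2 * ?J n n')"
    by simp
  moreover have "0 \<le> arcsin \<eta>"
    using arcsin_le_arcsin[of 0 \<eta>] a by simp
  ultimately have "3 * pi\<^sup>2 * ?J m m' + (a - a') / 2 * (4 * pi * arcsin \<eta>) \<le> 3 * pi\<^sup>2 * ?J n n'"
    using a J[of m m'] J[of n n'] by (simp add: ennreal_mult'[symmetric] ennreal_plus[symmetric] del: ennreal_plus)
  \<comment> \<open>Dividing by \<open>3 * pi\<^sup>2\<close> turns this into
    \<open>2 * arcsin \<eta> / (3 * pi)\<close> times the increment.\<close>
  moreover have "(a - a') / 2 * (4 * pi * arcsin \<eta>) = pi * ((a - a') * (2 * arcsin \<eta>))"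
    by simp
  ultimately have "pi * ((a - a') * (2 * arcsin \<eta>)) \<le> pi * (3 * pi * (?J n n' - ?J m m'))"
    by (simp only: power2_eq_square algebra_simps)
  then have "(a - a') * (2 * arcsin \<eta>) \<le> 3 * pi * (?J n n' - ?J m m')"
    by (subst (asm) mult_le_cancel_left_pos) auto
  then show ?thesis by (simp add: field_simps)
qed

section \<open>The pair moment as a function of the absolute correlation\<close>

lemma pair_char_abs: "pair_char \<bar>a\<bar> r s = pair_char a r s"
  by (auto simp: pair_char_def abs_if)

text \<open>By evenness of \<open>cosh\<close>, every admissible pair gives the same frequency
  integral; the given pair itself shows that no other value satisfies the definite
  description.\<close>

lemma I2_eq_pair_moment:
  fixes n n' :: "real^3"
  assumes n: "norm n = 1" "norm n' = 1"
  shows "I2 \<bar>n \<bullet> n'\<bar> = (\<integral>U. \<bar>U \<bullet> n\<bar> * \<bar>U \<bullet> n'\<bar> \<partial>uniform_S2)"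
  unfolding I2_def
proof (rule the_equality)
  let ?J = "\<lambda>n n'. \<integral>U. \<bar>U \<bullet> n\<bar> * \<bar>U \<bullet> n'\<bar> \<partial>uniform_S2"
  have J: "0 \<le> ?J n n'" for n n' :: "real^3"
    by (rule Bochner_Integration.integral_nonneg) simp
  show "\<forall>m\<in>sphere 0 1. \<forall>m'\<in>sphere 0 1. \<bar>m \<bullet> m'\<bar> = \<bar>n \<bullet> n'\<bar> \<longrightarrow> ?J m m' = ?J n n'"
  proof (intro ballI impI)
    fix m m' :: "real^3" assume m: "m \<in> sphere 0 1" "m' \<in> sphere 0 1" "\<bar>m \<bullet> m'\<bar> = \<bar>n \<bullet> n'\<bar>"
    then have "pair_char (m \<bullet> m') r s = pair_char (n \<bullet> n') r s" for r s
      by (metis pair_char_abs)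
    then have "ennreal (3 * pi\<^sup>2 * ?J m m') = ennreal (3 * pi\<^sup>2 * ?J n n')"
      using pair_moment_integral[OF n] pair_moment_integral[of m m'] m by simp
    then show "?J m m' = ?J n n'"
      using J[of m m'] J[of n n'] by simp
  qed
qed (use n in auto)

text \<open>Supplies vectors for every prescribed correlation, so that \<open>I2\<close> can be
  evaluated at given arguments.\<close>

lemma unit_pair_with_inner:
  fixes a :: real
  assumes "\<bar>a\<bar> \<le> 1"
  obtains n n' :: "real^3" where "norm n = 1" "norm n' = 1" "n \<bullet> n' = a"
proof
  have "a\<^sup>2 \<le> 1" using assms by (simp add: abs_square_le_1)
  then show "norm (vector [1, 0, 0] :: real^3) = 1" "norm (vector [a, sqrt (1 - a\<^sup>2), 0] :: real^3) = 1"
    by (simp_all add: norm_eq_sqrt_inner inner_vec_def sum_3 flip: power2_eq_square)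
  show "vector [1, 0, 0] \<bullet> (vector [a, sqrt (1 - a\<^sup>2), 0] :: real^3) = a"
    by (simp add: inner_vec_def sum_3)
qed

lemma I2_gap:
  assumes a: "0 < \<eta>" "\<eta> < 1" "\<eta> \<le> a'" "a' \<le> a" "a \<le> 1"
  shows "(a - a') * (2 * arcsin \<eta>) / (3 * pi) \<le> I2 a - I2 a'"
proof -
  obtain n n' :: "real^3" where n: "norm n = 1" "norm n' = 1" "n \<bullet> n' = a"
    using unit_pair_with_inner[of a] a by auto
  obtain m m' :: "real^3" where m: "norm m = 1" "norm m' = 1" "m \<bullet> m' = a'"
    using unit_pair_with_inner[of a'] a by auto
  show ?thesis
    using pair_moment_gap[OF n m, of \<eta>] I2_eq_pair_moment[OF n(1,2)] I2_eq_pair_moment[OF m(1,2)] a n m by simp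
qed

lemma I2_reconstruction:
  assumes \<eta>: "0 < \<eta>" and a: "a \<in> {\<eta>..1}" "a' \<in> {\<eta>..1}"
  shows "\<bar>a - a'\<bar> \<le> 3 * pi / (2 * arcsin \<eta>) * \<bar>I2 a - I2 a'\<bar>"
proof (cases "\<eta> < 1")
  case True
  have as: "0 < arcsin \<eta>"
    using arcsin_less_arcsin[of 0 \<eta>] \<eta> True by simp
  have *: "x - x' \<le> 3 * pi / (2 * arcsin \<eta>) * \<bar>I2 x - I2 x'\<bar>"
    if "\<eta> \<le> x'" "x' \<le> x" "x \<le> 1" for x x'
  proof -
    have "(x - x') * (2 * arcsin \<eta>) / (3 * pi) \<le> \<bar>I2 x - I2 x'\<bar>"
      using I2_gap[OF \<eta> True that] by linarith
    then show ?thesis using as by (simp add: field_simps)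
  qed
  show ?thesis
    using *[of a a'] *[of a' a] a by (cases "a \<le> a'") (auto simp: abs_minus_commute)
next
  case False
  \<comment> \<open>For \<open>\<eta> \<ge> 1\<close> the interval contains at most the point
    1.\<close>
  then have "a = a'" using a by auto
  then show ?thesis by simp
qed

section \<open>Assembly of the pair and triple bounds\<close>

theorem proposition7p5:
  fixes m :: nat and E :: "nat set set" and \<eta> :: real
  assumes "correlation_graph m E"
    and "generated_by_triangles E"
    and "\<eta> > 0"
  shows "(\<forall>a\<in>{\<eta>..1}. \<forall>a'\<in>{\<eta>..1}. \<bar>a - a'\<bar> \<le> 3 * pi / (2 * arcsin \<eta>) * \<bar>I2 a - I2 a'\<bar>) \<and>
    (\<forall>n\<in>bounded_class m E \<eta>. \<forall>i j k a b c.
       is_triangle E i j k \<longrightarrow>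
       a = \<bar>n i \<bullet> n j\<bar> \<longrightarrow> b = \<bar>n i \<bullet> n k\<bar> \<longrightarrow> c = \<bar>n j \<bullet> n k\<bar> \<longrightarrow>
       a \<in> {\<eta>..<1} \<longrightarrow> b \<in> {\<eta>..<1} \<longrightarrow> c \<in> {\<eta>..<1} \<longrightarrow>
       pos_semidef (G_plus a b c) \<longrightarrow> pos_semidef (G_minus a b c) \<longrightarrow>
       J_plus a b c - J_minus a b c \<ge> \<eta> ^ 3 / (2 * pi))"
proof (intro conjI ballI allI impI)
  fix a a' assume "a \<in> {\<eta>..1}" "a' \<in> {\<eta>..1}"
  then show "\<bar>a - a'\<bar> \<le> 3 * pi / (2 * arcsin \<eta>) * \<bar>I2 a - I2 a'\<bar>"
    by (rule I2_reconstruction[OF assms(3)])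
next
  fix a b c
  assume abc: "a \<in> {\<eta>..<1}" "b \<in> {\<eta>..<1}" "c \<in> {\<eta>..<1}"
    and psd: "pos_semidef (G_plus a b c)" "pos_semidef (G_minus a b c)"
  have "\<eta> ^ 3 \<le> a * b * c"
    unfolding power3_eq_cube using abc assms(3) by (intro mult_mono) auto
  then have "\<eta> ^ 3 / (2 * pi) \<le> a * b * c / (2 * pi)"
    by (rule divide_right_mono) simp
  also have "\<dots> \<le> J_plus a b c - J_minus a b c"
    using abc assms(3) psd by (intro J_gap) auto
  finally show "\<eta> ^ 3 / (2 * pi) \<le> J_plus a b c - J_minus a b c" .
qed

end
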